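(* Assume the standing hypotheses (S) hold for every time step $\tau$ in a family $\tau\downarrow0$ (if $\lambda<0$, additionally $|\lambda|\tau<1$), with initial data $X_0^\tau\in\mathbb H$ satisfying $\lim_{\tau\downarrow0}\|X_0^\tau-\mathrm{Id}\|_{\mathbb H}=0$ and $\sup_\tau\|\nabla\phi^{\#}_{\rho_0}(X_0^\tau)\|_{\mathbb H}<\infty$. Then there is a locally Lipschitz curve $X:[0,\infty)\to\mathbb H$ such that for every $T>0$, $\sup_{t\in[0,T]}\|X(t)-\underline X_t^\tau\|_{\mathbb H}\to0$ as $\tau\downarrow0$. Moreover, with $\rho_t:=(X(t))_{\#}\rho_0$ and $\rho_t^\tau:=(\underline X_t^\tau)_{\#}\rho_0$, for every $t\ge0$ and every admissible $\tau$, \[W_2(\rho_t,\rho_t^\tau)\le\|X(t)-\underline X_t^\tau\|_{\mathbb H}\le\begin{cases}\sqrt3\|X_0^\tau-\mathrm{Id}\|_{\mathbb H}+\frac{\sqrt{33}}2\tau\|\nabla\phi^{\#}_{\rho_0}(X_0^\tau)\|_{\mathbb H},&\lambda\ge0,\\[0.5em]\sqrt3e^{-\lambda_\tau t}\|X_0^\tau-\mathrm{Id}\|_{\mathbb H}+\sqrt3\,C(\lambda_\tau,t,\tau)\,\tau e^{-\lambda_\tau t}\|\nabla\phi^{\#}_{\rho_0}(X_0^\tau)\|_{\mathbb H},&\lambda<0,\end{cases}\] where $C(\lambda_\tau,t,\tau):=\big(1+|\lambda_\tau|(t+\tau)\big)e^{|\lambda_\tau|\tau}+\sqrt{\tfr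ac34+\big(1+\tfrac73|\lambda_\tau|(t+\tau)\big)e^{2|\lambda_\tau|\tau}}$.
   Context: $\lambda_\tau:=\frac1{2\tau}\log\frac{1+\lambda\tau}{1-\lambda\tau}$; $\underline X_t^\tau:=X_n^\tau$ for $t\in[n\tau,(n+1)\tau)$; $W_2$ is the quadratic Wasserstein distance; $\mathrm{Id}$ the identity map. Standing hypotheses (S): $\rho_0\in\mathcal P_2(\mathbb R^d)$; $\mathbb H=L^2(\mathbb R^d;\rho_0)$ is the Hilbert space of $\rho_0$-square-integrable maps $\mathbb R^d\to\mathbb R^d$ with $\langle\xi_1,\xi_2\rangle_{\mathbb H}=\int\langle\xi_1,\xi_2\rangle d\rho_0$; $\phi:\mathcal P_2(\mathbb R^d)\to\mathbb R$ has lift $\phi^{\#}_{\rho_0}(\xi):=\phi(\xi_{\#}\rho_0)$ which is Fréchet differentiable on $\mathbb H$ (gradient $\nabla\phi^{\#}_{\rho_0}$), $\lambda$-convex on $\mathbb H$ for some $\lambda\in\mathbb R$ (i.e. $\phi^{\#}_{\rho_0}((1-t)\xi_1+t\xi_2)\le(1-t)\phi^{\#}_{\rho_0}(\xi_1)+t\phi^{\#}_{\rho_0}(\xi_2)-\frac\lambda2t(1-t)\|\xi_1-\xi_2\|_{\mathbb H}^2$), and $\inf_{\mathbb H}\phi^{\#}_{\rho_0}>-\infty$; the time step $\tau>0$ satisfies $\lambda/2+1/\tau>0$; $X_0^\tau\in\mathbb H$. Lagrangian trapezoidal scheme: $X_{n+1}^\tau$ is the (unique) minimizer over $\xi\in\mathbb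 H$ of $\tfrac12\phi^{\#}_{\rho_0}(\xi)+\tfrac12\langle\nabla\phi^{\#}_{\rho_0}(X_n^\tau),\xi\rangle_{\mathbb H}+\tfrac1{2\tau}\|\xi-X_n^\tau\|^2_{\mathbb H}$; equivalently $X_{n+1}^\tau=X_n^\tau-\frac\tau2\big(\nabla\phi^{\#}_{\rho_0}(X_{n+1}^\tau)+\nabla\phi^{\#}_{\rho_0}(X_n^\tau)\big)$. *)

theory Defs
  imports "HOL-Probability.Probability"
begin

definition P2 :: "'a::euclidean_space measure set" where
  "P2 = {\<mu>. prob_space \<mu> \<and> sets \<mu> = sets borel \<and> integrable \<mu> (\<lambda>x. (norm x)\<^sup>2)}"

text \<open>The Hilbert space H = L^2(R^d; rho0), represented by square-integrable maps
  (elements are functions, inner product and norm are the L^2 ones).\<close>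
definition L2 :: "'a::euclidean_space measure \<Rightarrow> ('a \<Rightarrow> 'a) set" where
  "L2 M = {\<xi>. \<xi> \<in> borel_measurable M \<and> integrable M (\<lambda>x. (norm (\<xi> x))\<^sup>2)}"

definition hinner :: "'a::euclidean_space measure \<Rightarrow> ('a \<Rightarrow> 'a) \<Rightarrow> ('a \<Rightarrow> 'a) \<Rightarrow> real" where
  "hinner M \<xi> \<eta> = (\<integral>x. \<xi> x \<bullet> \<eta> x \<partial>M)"

definition hnorm :: "'a::euclidean_space measure \<Rightarrow> ('a \<Rightarrow> 'a) \<Rightarrow> real" where
  "hnorm M \<xi> = sqrt (\<integral>x. (norm (\<xi> x))\<^sup>2 \<partial>M)"

definition lift :: "('a::euclidean_space measure \<Rightarrow> real) \<Rightarrow> 'a measure \<Rightarrow> ('a \<Rightarrow> 'a) \<Rightarrow> real" where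
  "lift \<phi> M \<xi> = \<phi> (distr M borel \<xi>)"

definition frechet_gradient ::
  "'a::euclidean_space measure \<Rightarrow> (('a \<Rightarrow> 'a) \<Rightarrow> real) \<Rightarrow> (('a \<Rightarrow> 'a) \<Rightarrow> ('a \<Rightarrow> 'a)) \<Rightarrow> bool" where
  "frechet_gradient M F G \<longleftrightarrow>
     (\<forall>\<xi>\<in>L2 M. G \<xi> \<in> L2 M) \<and>
     (\<forall>\<xi>\<in>L2 M. \<forall>\<epsilon>>0. \<exists>\<delta>>0. \<forall>h\<in>L2 M. hnorm M h < \<delta> \<longrightarrow>
        \<bar>F (\<lambda>x. \<xi> x + h x) - F \<xi> - hinner M (G \<xi>) h\<bar> \<le> \<epsilon> * hnorm M h)"

definition lambda_convex :: "'a::euclidean_space measure \<Rightarrow> real \<Rightarrow> (('a \<Rightarrow> 'a) \<Rightarrow> real) \<Rightarrow> bool" where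
  "lambda_convex M lam F \<longleftrightarrow>
     (\<forall>\<xi>1\<in>L2 M. \<forall>\<xi>2\<in>L2 M. \<forall>t\<in>{0..1}.
        F (\<lambda>x. (1 - t) *\<^sub>R \<xi>1 x + t *\<^sub>R \<xi>2 x)
          \<le> (1 - t) * F \<xi>1 + t * F \<xi>2 - lam / 2 * t * (1 - t) * (hnorm M (\<lambda>x. \<xi>1 x - \<xi>2 x))\<^sup>2)"

definition couplings :: "'a::euclidean_space measure \<Rightarrow> 'a measure \<Rightarrow> ('a \<times> 'a) measure set" where
  "couplings \<mu> \<nu> = {\<pi>. prob_space \<pi> \<and> sets \<pi> = sets (borel :: ('a \<times> 'a) measure) \<and>
                        distr \<pi> borel fst = \<mu> \<and> distr \<pi> borel snd = \<nu>}"

definition W2 :: "'a::euclidean_space measure \<Rightarrow> 'a measure \<Rightarrow> real" where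
  "W2 \<mu> \<nu> = sqrt (enn2real (INF \<pi>\<in>couplings \<mu> \<nu>. \<integral>\<^sup>+ p. ennreal ((norm (fst p - snd p))\<^sup>2) \<partial>\<pi>))"

definition trap_objective ::
  "'a::euclidean_space measure \<Rightarrow> (('a \<Rightarrow> 'a) \<Rightarrow> real) \<Rightarrow> (('a \<Rightarrow> 'a) \<Rightarrow> ('a \<Rightarrow> 'a)) \<Rightarrow> real
     \<Rightarrow> ('a \<Rightarrow> 'a) \<Rightarrow> ('a \<Rightarrow> 'a) \<Rightarrow> real" where
  "trap_objective M F G \<tau> X \<xi> =
     F \<xi> / 2 + hinner M (G X) \<xi> / 2 + (hnorm M (\<lambda>x. \<xi> x - X x))\<^sup>2 / (2 * \<tau>)"

definition trap_step ::
  "'a::euclidean_space measure \<Rightarrow> (('a \<Rightarrow> 'a) \<Rightarrow> real) \<Rightarrow> (('a \<Rightarrow> 'a) \<Rightarrow> ('a \<Rightarrow> 'a)) \<Rightarrow> real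
     \<Rightarrow> ('a \<Rightarrow> 'a) \<Rightarrow> ('a \<Rightarrow> 'a) \<Rightarrow> bool" where
  "trap_step M F G \<tau> X Y \<longleftrightarrow> Y \<in> L2 M \<and>
     (\<forall>\<xi>\<in>L2 M. trap_objective M F G \<tau> X Y \<le> trap_objective M F G \<tau> X \<xi>)"

definition interp :: "(nat \<Rightarrow> 'b) \<Rightarrow> real \<Rightarrow> real \<Rightarrow> 'b" where
  "interp X \<tau> t = X (nat \<lfloor>t / \<tau>\<rfloor>)"

definition lambda_tau :: "real \<Rightarrow> real \<Rightarrow> real" where
  "lambda_tau lam \<tau> = 1 / (2 * \<tau>) * ln ((1 + lam * \<tau>) / (1 - lam * \<tau>))"

definition Cconst :: "real \<Rightarrow> real \<Rightarrow> real \<Rightarrow> real" where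
  "Cconst l t \<tau> = (1 + \<bar>l\<bar> * (t + \<tau>)) * exp (\<bar>l\<bar> * \<tau>)
      + sqrt (3 / 4 + (1 + 7 / 3 * \<bar>l\<bar> * (t + \<tau>)) * exp (2 * \<bar>l\<bar> * \<tau>))"

end

theory Submission
  imports Defs "HOL-Library.Function_Algebras"
begin

text \<open>
  Let \<open>w\<close> and \<open>v\<close> be the piecewise linear interpolants of the trapezoidal schemes with steps \<open>\<tau>\<close>
  and \<open>\<eta>\<close>. By semiconvexity the derivative of \<open>\<parallel>w - v\<parallel>\<^sup>2 / 2\<close> is bounded by \<open>\<mu> \<parallel>w - v\<parallel>\<^sup>2\<close>, where
  \<open>\<mu>\<close> is the negative part of \<open>\<lambda>\<close>, plus one error rate per scheme and small terms of order \<open>\<mu>\<close>.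
  Over a full step the error rate integrates to \<open>\<tau>\<^sup>2 / 8\<close> times the decrease of the squared gradient
  norm, so its primitive telescopes and is bounded by \<open>\<tau>\<^sup>2 \<parallel>a\<^sub>0\<parallel>\<^sup>2 / 8\<close> up to a term of order \<open>\<mu>\<close>.
  Gronwall's argument then bounds the distance of the two interpolants linearly in \<open>\<tau>\<close> and \<open>\<eta>\<close>. Hence the
  interpolants converge in the complete space \<open>L\<^sup>2\<close>, and letting \<open>\<eta>\<close> tend to \<open>0\<close> yields the error
  estimate, with constants better than the required ones.
\<close>

text \<open>Only semiconvexity is at hand: the gradient need not be Lipschitz, so a truncation error
  cannot be estimated by smoothness. It is expressed instead through values of \<open>f\<close> and
  pairings of gradients with increments. The values of \<open>f\<close> drop out over a full step
  because their factor \<open>1/2 - s\<close> has mean zero on the cell; the pairings become a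
  difference of squared gradient norms because the Euler-Lagrange equation is tested with the
  difference of consecutive gradients. The terms of order \<open>mu\<close> contain increments,
  hence gradient norms at later times. The same test shows that the squared gradient norm grows by
  at most the factor \<open>(1 + mu * \<tau>) / (1 - mu * \<tau>)\<close> per step; its logarithm
  per unit time is twice the absolute value of \<open>lambda_tau\<close> when \<open>lam\<close> is
  negative, which is the origin of that rate. Comparing two schemes with each other, rather than one
  scheme with a given flow, lets a single inequality provide both the existence of the limit and the
  error estimate.\<close>

instantiation "fun" :: (type, scaleR) scaleR
begin

definition "scaleR c f = (\<lambda>x. c *\<^sub>R f x)"

instance ..

end

lemma scaleR_fun_apply [simp]: "(c *\<^sub>R f) x = c *\<^sub>R f x"
  by (simp add: scaleR_fun_def)

instance "fun" :: (type, real_vector) real_vector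
  by standard (simp_all add: fun_eq_iff scaleR_add_right scaleR_add_left)

text \<open>Elements of \<open>L\<^sup>2\<close> are functions rather than classes modulo null sets, so the inner product is
  only semidefinite.\<close>

locale semi_inner_space =
  fixes S :: "'v::real_vector set" and ip :: "'v \<Rightarrow> 'v \<Rightarrow> real"
  assumes subspace: "subspace S"
    and ip_add_left: "x \<in> S \<Longrightarrow> y \<in> S \<Longrightarrow> z \<in> S \<Longrightarrow> ip (x + y) z = ip x z + ip y z"
    and ip_scale_left: "x \<in> S \<Longrightarrow> z \<in> S \<Longrightarrow> ip (c *\<^sub>R x) z = c * ip x z"
    and ip_commute: "ip x y = ip y x"
    and ip_nonneg: "0 \<le> ip x x"
begin

definition nrm :: "'v \<Rightarrow> real" where
  "nrm x = sqrt (ip x x)"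

lemma mem_S [simp]:
  "x \<in> S \<Longrightarrow> y \<in> S \<Longrightarrow> x + y \<in> S"
  "x \<in> S \<Longrightarrow> y \<in> S \<Longrightarrow> x - y \<in> S"
  "x \<in> S \<Longrightarrow> c *\<^sub>R x \<in> S"
  "x \<in> S \<Longrightarrow> - x \<in> S"
  using subspace by (auto simp: subspace_add subspace_diff subspace_scale subspace_neg)

lemma ip_add_right: "x \<in> S \<Longrightarrow> y \<in> S \<Longrightarrow> z \<in> S \<Longrightarrow> ip z (x + y) = ip z x + ip z y"
  by (metis ip_add_left ip_commute)

lemma ip_scale_right: "x \<in> S \<Longrightarrow> z \<in> S \<Longrightarrow> ip z (c *\<^sub>R x) = c * ip z x"
  by (metis ip_scale_left ip_commute)

lemma ip_diff_left: "x \<in> S \<Longrightarrow> y \<in> S \<Longrightarrow> z \<in> S \<Longrightarrow> ip (x - y) z = ip x z - ip y z"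
  using ip_add_left[of "x - y" y z] by simp

lemma ip_diff_right: "x \<in> S \<Longrightarrow> y \<in> S \<Longrightarrow> z \<in> S \<Longrightarrow> ip z (x - y) = ip z x - ip z y"
  by (metis ip_diff_left ip_commute)

lemma ip_minus_left: "x \<in> S \<Longrightarrow> z \<in> S \<Longrightarrow> ip (- x) z = - ip x z"
  using ip_scale_left[of x z "-1"] by simp

lemmas ip_linear = ip_add_left ip_add_right ip_diff_left ip_diff_right ip_scale_left ip_scale_right

lemma nrm_nonneg [simp]: "0 \<le> nrm x"
  by (simp add: nrm_def ip_nonneg)

lemma nrm_square: "(nrm x)\<^sup>2 = ip x x"
  by (simp add: nrm_def ip_nonneg)

lemma ip_affine_square:
  assumes "u \<in> S" "v \<in> S"
  shows "ip (u + t *\<^sub>R v) (u + t *\<^sub>R v) = ip u u + 2 * t * ip u v + t\<^sup>2 * ip v v"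
  using assms by (simp add: ip_linear ip_commute[of v u] power2_eq_square algebra_simps)

lemma Cauchy_Schwarz:
  assumes "x \<in> S" "y \<in> S"
  shows "ip x y \<le> nrm x * nrm y"
proof -
  have pos: "0 \<le> ip x x + 2 * t * ip x y + t\<^sup>2 * ip y y" for t
    using ip_affine_square[OF assms] ip_nonneg[of "x + t *\<^sub>R y"] by simp
  have "(ip x y)\<^sup>2 \<le> ip x x * ip y y"
  proof (cases "ip y y = 0")
    case True
    have "ip x y = 0"
    proof (rule ccontr)
      assume "ip x y \<noteq> 0"
      then show False
        \<comment> \<open>For a null vector \<open>y\<close> the quadratic in \<open>t\<close>
          degenerates to an affine function; at this \<open>t\<close> its value is -1.\<close>
        using pos[of "- (ip x x + 1) / (2 * ip x y)"] True by (simp add: field_simps)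
    qed
    with True show ?thesis by simp
  next
    case False
    then have "0 < ip y y" using ip_nonneg[of y] by simp
    then show ?thesis
      using pos[of "- ip x y / ip y y"] by (simp add: field_simps power2_eq_square)
  qed
  also have "\<dots> = (nrm x * nrm y)\<^sup>2"
    by (simp add: power_mult_distrib nrm_square)
  finally show ?thesis
    by (rule power2_le_imp_le) simp
qed

lemma nrm_triangle:
  assumes "x \<in> S" "y \<in> S"
  shows "nrm (x + y) \<le> nrm x + nrm y"
proof (rule power2_le_imp_le)
  show "(nrm (x + y))\<^sup>2 \<le> (nrm x + nrm y)\<^sup>2"
    using Cauchy_Schwarz[OF assms] assms
    by (simp add: nrm_square power2_sum ip_linear ip_commute[of y x])
qed simp

lemma nrm_scale: "x \<in> S \<Longrightarrow> nrm (c *\<^sub>R x) = \<bar>c\<bar> * nrm x"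
  by (simp add: nrm_def ip_linear real_sqrt_mult flip: mult.assoc)

lemma nrm_minus_commute: "x \<in> S \<Longrightarrow> y \<in> S \<Longrightarrow> nrm (x - y) = nrm (y - x)"
  using nrm_scale[of "x - y" "-1"] by simp

lemma nrm_triangle_diff:
  assumes "x \<in> S" "y \<in> S" "z \<in> S"
  shows "nrm (x - z) \<le> nrm (x - y) + nrm (y - z)"
  using nrm_triangle[of "x - y" "y - z"] assms by simp

end

section \<open>Semiconvex functions and trapezoidal runs\<close>

locale semiconvex_flow = semi_inner_space S ip for S :: "'v::real_vector set" and ip +
  fixes f :: "'v \<Rightarrow> real" and mu :: real
  assumes mu_nonneg: "0 \<le> mu"
    and semiconvex: "x \<in> S \<Longrightarrow> y \<in> S \<Longrightarrow> 0 \<le> s \<Longrightarrow> s \<le> 1 \<Longrightarrow>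
      f (x + s *\<^sub>R (y - x)) \<le> (1 - s) * f x + s * f y + mu / 2 * s * (1 - s) * ip (y - x) (y - x)"
begin

text \<open>The Euler--Lagrange equation of a step is only required weakly because \<open>ip\<close> may have null
  vectors; \<open>a n\<close> stands for the gradient at \<open>X n\<close>.\<close>

definition trap_run :: "real \<Rightarrow> real \<Rightarrow> (nat \<Rightarrow> 'v) \<Rightarrow> (nat \<Rightarrow> 'v) \<Rightarrow> bool" where
  "trap_run l \<tau> X a \<longleftrightarrow> 0 < \<tau> \<and> mu * \<tau> \<le> 1 \<and> (\<forall>n. X n \<in> S \<and> a n \<in> S) \<and>
     (\<forall>n. \<forall>z\<in>S. ip (X (Suc n) - X n) z = - \<tau> / 2 * (ip (a n) z + ip (a (Suc n)) z)) \<and>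
     (\<forall>n. \<forall>y\<in>S. f (X n) + ip (a n) (y - X n) - mu / 2 * ip (y - X n) (y - X n) \<le> f y) \<and>
     (\<forall>n. nrm (a n) \<le> exp (l * (real n * \<tau>)) * nrm (a 0))"

lemma trap_runD:
  assumes "trap_run l \<tau> X a"
  shows "0 < \<tau>" "mu * \<tau> \<le> 1" "X n \<in> S" "a n \<in> S"
    and "z \<in> S \<Longrightarrow> ip (X (Suc n) - X n) z = - \<tau> / 2 * (ip (a n) z + ip (a (Suc n)) z)"
    and "y \<in> S \<Longrightarrow> f (X n) + ip (a n) (y - X n) - mu / 2 * ip (y - X n) (y - X n) \<le> f y"
    and "nrm (a n) \<le> exp (l * (real n * \<tau>)) * nrm (a 0)"
  using assms by (auto simp: trap_run_def)

text \<open>The scheme moves along the mean of the end gradients, so the mean of the subgradient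
  inequalities at \<open>x0\<close> and \<open>x1\<close> produces the left-hand side exactly. The
  bracket collects what is lost by moving the base points from the ends of the step to the
  intermediate point \<open>w\<close>.\<close>

lemma trap_step_inequality:
  assumes S: "x0 \<in> S" "x1 \<in> S" "a0 \<in> S" "a1 \<in> S" "y \<in> S" and \<tau>: "0 < \<tau>" and s: "0 \<le> s" "s \<le> 1"
    and EL: "\<And>z. z \<in> S \<Longrightarrow> ip (x1 - x0) z = - \<tau> / 2 * (ip a0 z + ip a1 z)"
    and sub0: "\<And>y. y \<in> S \<Longrightarrow> f x0 + ip a0 (y - x0) - mu / 2 * ip (y - x0) (y - x0) \<le> f y"
    and sub1: "\<And>y. y \<in> S \<Longrightarrow> f x1 + ip a1 (y - x1) - mu / 2 * ip (y - x1) (y - x1) \<le> f y"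
    and d: "d = x1 - x0" and w: "w = x0 + s *\<^sub>R d"
  shows "ip d (w - y) / \<tau> \<le> f y - f w
     + ((1/2 - s) * (f x0 - f x1) - s / 2 * ip a0 d + (1 - s) / 2 * ip a1 d)
     + mu / 2 * ip (w - y) (w - y) + mu / 2 * (nrm d * nrm (w - y)) + mu / 4 * ip d d"
proof -
  define v where "v = w - y"
  have [simp]: "d \<in> S" "w \<in> S" "v \<in> S" using S by (auto simp: d w v_def)
  have y0: "y - x0 = s *\<^sub>R d - v" and y1: "y - x1 = (s - 1) *\<^sub>R d - v"
    by (auto simp: v_def w d algebra_simps)
  have 0: "f x0 + (s * ip a0 d - ip a0 v) - mu / 2 * (s^2 * ip d d - 2 * s * ip d v + ip v v) \<le> f y"
    using sub0[OF S(5)] S unfolding y0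
    by (simp add: ip_linear ip_commute[of v d] power2_eq_square algebra_simps)
  have 1: "f x1 + ((s - 1) * ip a1 d - ip a1 v)
      - mu / 2 * ((s - 1)^2 * ip d d - 2 * (s - 1) * ip d v + ip v v) \<le> f y"
    using sub1[OF S(5)] S unfolding y1
    by (simp add: ip_linear ip_commute[of v d] power2_eq_square algebra_simps)
  have 2: "f w \<le> (1 - s) * f x0 + s * f x1 + mu / 2 * s * (1 - s) * ip d d"
    using semiconvex[OF S(1,2) s] by (simp add: w d)
  have 3: "ip d v / \<tau> = - (ip a0 v + ip a1 v) / 2"
    using EL[of v] \<tau> by (simp add: d field_simps)
  have 4: "(2 * s - 1) * - ip d v \<le> nrm d * nrm v"
  proof -
    have "\<bar>ip d v\<bar> \<le> nrm d * nrm v"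
      using Cauchy_Schwarz[of d v] Cauchy_Schwarz[of d "- v"] nrm_scale[of v "-1"] ip_scale_right[of v d "-1"]
      by (simp add: abs_le_iff)
    moreover have "(2 * s - 1) * - ip d v \<le> \<bar>2 * s - 1\<bar> * \<bar>ip d v\<bar>"
      by (metis abs_ge_self abs_minus_cancel abs_mult)
    moreover have "\<bar>2 * s - 1\<bar> * \<bar>ip d v\<bar> \<le> 1 * \<bar>ip d v\<bar>"
      using s by (intro mult_right_mono) auto
    ultimately show ?thesis by linarith
  qed
  \<comment> \<open>Half of \<open>0\<close> plus half of \<open>1\<close> plus \<open>2\<close>.
    The coefficients of \<open>ip d d\<close> add up to \<open>mu / 4\<close> because
    \<open>s^2 + (1 - s)^2 + 2 * s * (1 - s) = 1\<close>.\<close>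
  have "ip d v / \<tau> \<le> f y - f w
     + ((1/2 - s) * (f x0 - f x1) - s / 2 * ip a0 d + (1 - s) / 2 * ip a1 d)
     + mu / 2 * ip v v + mu / 2 * ((2 * s - 1) * - ip d v) + mu / 4 * ip d d"
    using 0 1 2 unfolding 3 by (simp add: field_simps power2_eq_square)
  also have "mu / 2 * ((2 * s - 1) * - ip d v) \<le> mu / 2 * (nrm d * nrm v)"
    using 4 mu_nonneg by (intro mult_left_mono) auto
  finally show ?thesis by (simp add: v_def)
qed

end

section \<open>Time grids, passing from cells to intervals, linear interpolation\<close>

lemma nat_floor_grid:
  fixes \<tau> :: real
  assumes "0 < \<tau>" "real n * \<tau> \<le> t" "t \<le> real (Suc n) * \<tau>"
  shows "nat \<lfloor>t / \<tau>\<rfloor> = n \<or> nat \<lfloor>t / \<tau>\<rfloor> = Suc n \<and> t = real (Suc n) * \<tau>"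
proof (cases "t = real (Suc n) * \<tau>")
  case True
  then have "t / \<tau> = real (Suc n)" using assms(1) by simp
  then have "nat \<lfloor>t / \<tau>\<rfloor> = Suc n" by (simp only: floor_of_nat nat_int)
  with True show ?thesis by simp
next
  case False
  then have "real n \<le> t / \<tau>" "t / \<tau> < real n + 1"
    using assms by (auto simp: field_simps)
  then have "\<lfloor>t / \<tau>\<rfloor> = int n" by (simp add: floor_eq_iff)
  then show ?thesis by simp
qed

lemma grid_cell_right:
  fixes \<tau> :: real
  assumes "0 < \<tau>" "0 \<le> t"
  obtains n where "n = nat \<lfloor>t / \<tau>\<rfloor>" "real n * \<tau> \<le> t" "t < real (Suc n) * \<tau>"
proof
  have "real (nat \<lfloor>t / \<tau>\<rfloor>) = real_of_int \<lfloor>t / \<tau>\<rfloor>" using assms by simp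
  then show "real (nat \<lfloor>t / \<tau>\<rfloor>) * \<tau> \<le> t" "t < real (Suc (nat \<lfloor>t / \<tau>\<rfloor>)) * \<tau>"
    using iffD1[OF pos_le_divide_eq[OF assms(1)] of_int_floor_le]
      iffD1[OF pos_divide_less_eq[OF assms(1)] real_of_int_floor_add_one_gt]
    by (auto simp: add.commute)
qed simp

text \<open>Here a grid point belongs to the cell that ends at it, as is needed to look to the left
  of that point.\<close>

lemma grid_cell_left:
  fixes \<tau> :: real
  assumes "0 < \<tau>" "0 < t"
  obtains n where "real n * \<tau> < t" "t \<le> real (Suc n) * \<tau>"
proof
  have "0 < \<lceil>t / \<tau>\<rceil>" using assms by simp
  then have "real (nat (\<lceil>t / \<tau>\<rceil> - 1)) = real_of_int \<lceil>t / \<tau>\<rceil> - 1" by simp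
  then show "real (nat (\<lceil>t / \<tau>\<rceil> - 1)) * \<tau> < t" "t \<le> real (Suc (nat (\<lceil>t / \<tau>\<rceil> - 1))) * \<tau>"
    using iffD1[OF pos_divide_le_eq[OF assms(1)] le_of_int_ceiling] assms ceiling_correct[of "t / \<tau>"]
    by (auto simp: field_simps)
qed

text \<open>The two step sizes are unrelated, so an explicit common refinement of the grids would be
  awkward. A bound on increments is additive over adjacent intervals, so it is enough to have it
  near each point, and bisection does the rest.\<close>

lemma increment_le_from_grid_cells:
  fixes g :: "real \<Rightarrow> real"
  assumes \<tau>: "0 < \<tau>" and \<eta>: "0 < \<eta>" and T: "0 \<le> T"
    and cell: "\<And>i j s t. real i * \<tau> \<le> s \<Longrightarrow> real j * \<eta> \<le> s \<Longrightarrow> s \<le> t \<Longrightarrow>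
      t \<le> real (Suc i) * \<tau> \<Longrightarrow> t \<le> real (Suc j) * \<eta> \<Longrightarrow> g t - g s \<le> C * (t - s)"
  shows "g T - g 0 \<le> C * T"
proof -
  \<comment> \<open>The guard restricts the bisection of \<open>Bolzano\<close> to nonnegative times.\<close>
  define P where "P a b \<longleftrightarrow> (0 \<le> a \<longrightarrow> g b - g a \<le> C * (b - a))" for a b
  have "P 0 T"
    using T
  proof (induction rule: Bolzano)
    case (trans a b c)
    then show ?case by (auto simp: P_def algebra_simps)
  next
    case (local x)
    obtain i where i: "real i * \<tau> \<le> x" "x < real (Suc i) * \<tau>"
      using grid_cell_right[OF \<tau> local(1)] by metis
    obtain j where j: "real j * \<eta> \<le> x" "x < real (Suc j) * \<eta>"
      using grid_cell_right[OF \<eta> local(1)] by metis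
    \<comment> \<open>To the left of \<open>x\<close> the relevant cells may differ from those to
      the right, in one grid or in both. At \<open>x = 0\<close> the only admissible left end is
      \<open>x\<close> itself.\<close>
    obtain c where c: "0 < c" "\<And>a. 0 \<le> a \<Longrightarrow> a \<le> x \<Longrightarrow> x - a < c \<Longrightarrow> g x - g a \<le> C * (x - a)"
    proof (cases "x = 0")
      case True
      then show ?thesis using that[of 1] by force
    next
      case False
      then have "0 < x" using local by simp
      obtain i' where i': "real i' * \<tau> < x" "x \<le> real (Suc i') * \<tau>"
        using grid_cell_left[OF \<tau> \<open>0 < x\<close>] by metis
      obtain j' where j': "real j' * \<eta> < x" "x \<le> real (Suc j') * \<eta>"
        using grid_cell_left[OF \<eta> \<open>0 < x\<close>] by metis
      show ?thesis
        using i' j' by (intro that[of "min (x - real i' * \<tau>) (x - real j' * \<eta>)"] cell[of i' _ j']) auto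
    qed
    \<comment> \<open>Within this radius an interval around \<open>x\<close> is split at
      \<open>x\<close>, and each half lies in one cell of both grids.\<close>
    have "0 < min c (min (real (Suc i) * \<tau> - x) (real (Suc j) * \<eta> - x))"
      using i j c by simp
    moreover have "g b - g a \<le> C * (b - a)"
      if "a \<le> x" "x \<le> b" "b - a < min c (min (real (Suc i) * \<tau> - x) (real (Suc j) * \<eta> - x))" "0 \<le> a"
      for a b
    proof -
      have "g b - g x \<le> C * (b - x)"
        using i j that by (intro cell[of i _ j]) auto
      moreover have "g x - g a \<le> C * (x - a)"
        using that by (intro c) auto
      ultimately show ?thesis by (simp add: algebra_simps)
    qed
    ultimately show ?case
      by (intro exI[of _ "min c (min (real (Suc i) * \<tau> - x) (real (Suc j) * \<eta> - x))"]) (auto simp: P_def)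
  qed
  then show ?thesis by (simp add: P_def)
qed

definition pw_linear :: "real \<Rightarrow> (nat \<Rightarrow> 'v::real_vector) \<Rightarrow> real \<Rightarrow> 'v" where
  "pw_linear \<tau> X t = (let n = nat \<lfloor>t / \<tau>\<rfloor> in X n + (t / \<tau> - real n) *\<^sub>R (X (Suc n) - X n))"

text \<open>The cell is closed: at its right end the floor already selects the next index, but
  parameter 0 there and parameter 1 here give the same point. Both ends of a cell can thus be
  treated by one formula.\<close>

lemma pw_linear_cell:
  assumes "0 < \<tau>" "real n * \<tau> \<le> t" "t \<le> real (Suc n) * \<tau>"
  shows "pw_linear \<tau> X t = X n + (t / \<tau> - real n) *\<^sub>R (X (Suc n) - X n)"
  using nat_floor_grid[OF assms] assms(1) by (auto simp: pw_linear_def Let_def)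

section \<open>Comparison of two schemes through their linear interpolants\<close>

context semiconvex_flow
begin

text \<open>The primitive in time of the error rate \<open>(1/2 - s) (f(X\<^sub>n) - f(X\<^sub>n\<^sub>+\<^sub>1)) - \<dots>\<close> occurring in
  \<open>trap_step_inequality\<close>, normalised so that consecutive cells match.\<close>

definition cell_defect :: "real \<Rightarrow> (nat \<Rightarrow> 'v) \<Rightarrow> (nat \<Rightarrow> 'v) \<Rightarrow> nat \<Rightarrow> real \<Rightarrow> real" where
  "cell_defect \<tau> X a n s = \<tau>\<^sup>2 / 8 * (ip (a 0) (a 0) - ip (a n) (a n))
     + \<tau> * ((s - s\<^sup>2) / 2 * (f (X n) - f (X (Suc n))) - s\<^sup>2 / 4 * ip (a n) (X (Suc n) - X n)
            + (s / 2 - s\<^sup>2 / 4) * ip (a (Suc n)) (X (Suc n) - X n))"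

definition defect :: "real \<Rightarrow> (nat \<Rightarrow> 'v) \<Rightarrow> (nat \<Rightarrow> 'v) \<Rightarrow> real \<Rightarrow> real" where
  "defect \<tau> X a t = (let n = nat \<lfloor>t / \<tau>\<rfloor> in cell_defect \<tau> X a n (t / \<tau> - real n))"

text \<open>The increment is, weakly, minus \<open>\<tau> / 2\<close> times the sum of the two
  gradients; paired with their difference it leaves a difference of squares. This is where the
  symmetric average in the scheme is exploited.\<close>

lemma trap_run_ip_increment:
  assumes "trap_run l \<tau> X a"
  shows "ip (a (Suc n)) (X (Suc n) - X n) - ip (a n) (X (Suc n) - X n)
    = \<tau> / 2 * (ip (a n) (a n) - ip (a (Suc n)) (a (Suc n)))"
proof -
  note r = trap_runD[OF assms]
  show ?thesis
    using r(5)[of "a n" n] r(5)[of "a (Suc n)" n] r(4)[of n] r(4)[of "Suc n"]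
    unfolding ip_commute[of "a n" "X (Suc n) - X n"] ip_commute[of "a (Suc n)" "X (Suc n) - X n"]
    by (simp add: ip_commute[of "a (Suc n)" "a n"] algebra_simps)
qed

lemma defect_cell:
  assumes run: "trap_run l \<tau> X a" and t: "real n * \<tau> \<le> t" "t \<le> real (Suc n) * \<tau>"
  shows "defect \<tau> X a t = cell_defect \<tau> X a n (t / \<tau> - real n)"
proof -
  have \<tau>: "0 < \<tau>" using trap_runD(1)[OF run] .
  \<comment> \<open>At \<open>s = 1\<close> the values of \<open>f\<close> drop out and the gradient
    pairings carry the weights 1/4 and -1/4, which explains the factor 1/8 in the telescoped
    part.\<close>
  have "cell_defect \<tau> X a n 1 = \<tau>\<^sup>2 / 8 * (ip (a 0) (a 0) - ip (a n) (a n))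
      + \<tau> / 4 * (ip (a (Suc n)) (X (Suc n) - X n) - ip (a n) (X (Suc n) - X n))"
    by (simp add: cell_defect_def algebra_simps)
  also have "\<dots> = cell_defect \<tau> X a (Suc n) 0"
    unfolding trap_run_ip_increment[OF run] by (simp add: cell_defect_def power2_eq_square algebra_simps)
  finally have "cell_defect \<tau> X a (Suc n) 0 = cell_defect \<tau> X a n 1" ..
  then show ?thesis
    using nat_floor_grid[OF \<tau> t] \<tau> by (auto simp: defect_def Let_def)
qed

lemma cell_defect_has_derivative:
  assumes "\<tau> \<noteq> 0" and s: "s = t / \<tau> - real n"
  shows "((\<lambda>t. cell_defect \<tau> X a n (t / \<tau> - real n)) has_real_derivative
     (1/2 - s) * (f (X n) - f (X (Suc n))) - s / 2 * ip (a n) (X (Suc n) - X n)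
       + (1 - s) / 2 * ip (a (Suc n)) (X (Suc n) - X n)) (at t)"
proof -
  have "(cell_defect \<tau> X a n has_real_derivative
      \<tau> * ((1 - 2 * s) / 2 * (f (X n) - f (X (Suc n))) - (2 * s) / 4 * ip (a n) (X (Suc n) - X n)
        + (1 / 2 - 2 * s / 4) * ip (a (Suc n)) (X (Suc n) - X n))) (at s)"
    unfolding cell_defect_def[abs_def] by (rule derivative_eq_intros refl | simp)+
  moreover have "((\<lambda>t. t / \<tau> - real n) has_real_derivative 1 / \<tau>) (at t)"
    using assms(1) by (auto intro!: derivative_eq_intros)
  ultimately show ?thesis
    unfolding s by (rule DERIV_cong[OF DERIV_chain2[where g = "\<lambda>t. t / \<tau> - real n"]]) (use assms(1) in \<open>simp add: diff_divide_distrib mult.commute\<close>)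
qed

text \<open>The Euler-Lagrange equation holds only against test vectors, so it is tested with the
  increment itself. As \<open>l\<close> is nonnegative, the growth factor at the end of the step
  also dominates the one at its start.\<close>

lemma trap_run_increment_le:
  assumes run: "trap_run l \<tau> X a" and l: "0 \<le> l"
  shows "nrm (X (Suc n) - X n) \<le> \<tau> * exp (l * (real (Suc n) * \<tau>)) * nrm (a 0)"
proof -
  note r = trap_runD[OF run]
  let ?d = "X (Suc n) - X n"
  have [simp]: "?d \<in> S" "a n \<in> S" "a (Suc n) \<in> S" using r by auto
  have "nrm (a n) \<le> exp (l * (real (Suc n) * \<tau>)) * nrm (a 0)"
    using r(1) l by (intro order.trans[OF r(7)] mult_right_mono) (auto intro!: mult_left_mono)
  moreover have "nrm (a (Suc n)) \<le> exp (l * (real (Suc n) * \<tau>)) * nrm (a 0)"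
    by (rule r(7))
  ultimately have *: "nrm (a n) + nrm (a (Suc n)) \<le> 2 * (exp (l * (real (Suc n) * \<tau>)) * nrm (a 0))"
    by simp
  have "nrm ?d * nrm ?d = ip ?d ?d"
    using nrm_square[of ?d] by (simp add: power2_eq_square)
  also have "\<dots> = \<tau> / 2 * (ip (- a n) ?d + ip (- a (Suc n)) ?d)"
    using r(5)[of ?d n] by (simp add: ip_minus_left field_simps del: minus_diff_eq)
  also have "\<dots> \<le> \<tau> / 2 * (nrm (a n) * nrm ?d + nrm (a (Suc n)) * nrm ?d)"
    using r(1) Cauchy_Schwarz[of "- a n" ?d] Cauchy_Schwarz[of "- a (Suc n)" ?d]
      nrm_scale[of "a n" "-1"] nrm_scale[of "a (Suc n)" "-1"]
    by (intro mult_left_mono add_mono) auto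
  also have "\<dots> = \<tau> / 2 * (nrm (a n) + nrm (a (Suc n))) * nrm ?d"
    by (simp add: algebra_simps)
  also have "\<dots> \<le> \<tau> / 2 * (2 * (exp (l * (real (Suc n) * \<tau>)) * nrm (a 0))) * nrm ?d"
    using * r(1) by (intro mult_right_mono mult_left_mono) auto
  finally have "nrm ?d * nrm ?d \<le> (\<tau> * exp (l * (real (Suc n) * \<tau>)) * nrm (a 0)) * nrm ?d"
    by simp
  \<comment> \<open>A factor \<open>nrm ?d\<close> is cancelled; if it vanishes, the claim is
    trivial.\<close>
  then show ?thesis
    using r(1) by (cases "nrm ?d = 0") (auto simp: less_le mult_le_cancel_right)
qed

text \<open>The factor \<open>exp (l * \<tau>)\<close> pays for replacing the right end of the cell
  by an arbitrary time \<open>t\<close> in it, so that all later bounds share the factor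
  \<open>exp (l * t)\<close>.\<close>

lemma trap_run_increment_le_exp:
  assumes run: "trap_run l \<tau> X a" and l: "0 \<le> l" and t: "real n * \<tau> \<le> t"
  shows "nrm (X (Suc n) - X n) \<le> \<tau> * exp (l * \<tau>) * nrm (a 0) * exp (l * t)"
proof -
  have "l * (real (Suc n) * \<tau>) \<le> l * (\<tau> + t)"
    using l t by (intro mult_left_mono) (auto simp: algebra_simps)
  then have "exp (l * (real (Suc n) * \<tau>)) \<le> exp (l * \<tau>) * exp (l * t)"
    by (simp add: algebra_simps flip: exp_add)
  then have "\<tau> * exp (l * (real (Suc n) * \<tau>)) * nrm (a 0)
      \<le> \<tau> * (exp (l * \<tau>) * exp (l * t)) * nrm (a 0)"
    using trap_runD(1)[OF run] by (intro mult_right_mono mult_left_mono) auto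
  with trap_run_increment_le[OF run l, of n] show ?thesis
    by (simp add: mult_ac)
qed

text \<open>The constant is 1/8 + 1/16. The first part is the telescoped bound: whatever the current
  cell adds is absorbed by the term subtracted for \<open>a n\<close>. The second is the
  semiconvexity loss, from \<open>s - s\<^sup>2 \<le> 1/4\<close> and
  \<open>mu * \<tau> \<le> 1\<close>.\<close>

lemma cell_defect_le:
  assumes run: "trap_run l \<tau> X a" and l: "0 \<le> l" and t: "real n * \<tau> \<le> t" "t \<le> real (Suc n) * \<tau>"
  shows "cell_defect \<tau> X a n (t / \<tau> - real n)
    \<le> 3 / 16 * (\<tau> * exp (l * \<tau>) * nrm (a 0))\<^sup>2 * exp (2 * l * t)"
proof -
  note r = trap_runD[OF run]
  let ?d = "X (Suc n) - X n"
  define s where "s = t / \<tau> - real n"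
  define D where "D = \<tau> * exp (l * \<tau>) * nrm (a 0)"
  have D: "0 \<le> D" using r(1) by (simp add: D_def)
  have s: "0 \<le> s" "s \<le> 1" using t r(1) by (auto simp: s_def field_simps)
  have t0: "0 \<le> t" using r(1) t(1) by (meson less_imp_le mult_nonneg_nonneg of_nat_0_le_iff order_trans)
  have d: "ip ?d ?d \<le> D\<^sup>2 * exp (2 * l * t)"
  proof -
    have "(nrm ?d)\<^sup>2 \<le> (D * exp (l * t))\<^sup>2"
      using trap_run_increment_le_exp[OF run l t(1)] by (intro power_mono) (auto simp: D_def)
    then show ?thesis
      by (simp only: nrm_square power_mult_distrib exp_double[of "l * t", symmetric] mult.assoc)
  qed
  \<comment> \<open>The subgradient inequality based at \<open>X n\<close> is the right one: the
    coefficient of \<open>ip (a n) ?d\<close> becomes the negative of that of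
    \<open>ip (a (Suc n)) ?d\<close>, so only their difference remains.\<close>
  have "f (X n) - f (X (Suc n)) \<le> - ip (a n) ?d + mu / 2 * ip ?d ?d"
    using r(6)[of "X (Suc n)" n] r(3) by simp
  then have "(s - s\<^sup>2) / 2 * (f (X n) - f (X (Suc n))) \<le> (s - s\<^sup>2) / 2 * (- ip (a n) ?d + mu / 2 * ip ?d ?d)"
    using s by (intro mult_left_mono) (auto simp: power2_eq_square mult_left_le)
  then have "\<tau> * ((s - s\<^sup>2) / 2 * (f (X n) - f (X (Suc n))) - s\<^sup>2 / 4 * ip (a n) ?d
        + (s / 2 - s\<^sup>2 / 4) * ip (a (Suc n)) ?d)
      \<le> \<tau> * ((s / 2 - s\<^sup>2 / 4) * (ip (a (Suc n)) ?d - ip (a n) ?d) + (s - s\<^sup>2) / 4 * mu * ip ?d ?d)"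
    using r(1) by (intro mult_left_mono) (auto simp: field_simps)
  also have "\<dots> = (s / 2 - s\<^sup>2 / 4) * (\<tau>\<^sup>2 / 2) * (ip (a n) (a n) - ip (a (Suc n)) (a (Suc n)))
       + (s - s\<^sup>2) / 4 * (mu * \<tau>) * ip ?d ?d"
  proof -
    have "\<tau> * (p * (\<tau> / 2 * q) + r / 4 * mu * u) = p * (\<tau>\<^sup>2 / 2) * q + r / 4 * (mu * \<tau>) * u" for p q r u
      by (simp add: power2_eq_square algebra_simps)
    then show ?thesis unfolding trap_run_ip_increment[OF run] .
  qed
  also have "(s / 2 - s\<^sup>2 / 4) * (\<tau>\<^sup>2 / 2) * (ip (a n) (a n) - ip (a (Suc n)) (a (Suc n)))
      \<le> \<tau>\<^sup>2 / 8 * ip (a n) (a n)"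
  proof -
    have "0 \<le> (1 - s)\<^sup>2" by simp
    then have c: "0 \<le> s / 2 - s\<^sup>2 / 4" "s / 2 - s\<^sup>2 / 4 \<le> 1 / 4"
      using s by (auto simp: power2_eq_square algebra_simps mult_left_le intro: order.trans[OF mult_left_le])
    have "(s / 2 - s\<^sup>2 / 4) * (\<tau>\<^sup>2 / 2) * (ip (a n) (a n) - ip (a (Suc n)) (a (Suc n)))
        \<le> (s / 2 - s\<^sup>2 / 4) * (\<tau>\<^sup>2 / 2) * ip (a n) (a n)"
      using c ip_nonneg by (intro mult_left_mono) auto
    also have "\<dots> \<le> 1 / 4 * (\<tau>\<^sup>2 / 2) * ip (a n) (a n)"
      using c ip_nonneg by (intro mult_right_mono) auto
    finally show ?thesis by simp
  qed
  also have "(s - s\<^sup>2) / 4 * (mu * \<tau>) * ip ?d ?d \<le> 1 / 16 * 1 * (D\<^sup>2 * exp (2 * l * t))"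
  proof -
    have "0 \<le> (1 - 2 * s)\<^sup>2" by simp
    then have "(s - s\<^sup>2) / 4 \<le> 1 / 16" "0 \<le> s - s\<^sup>2"
      using s by (auto simp: power2_eq_square algebra_simps mult_left_le)
    then show ?thesis
      using d r(1,2) mu_nonneg ip_nonneg by (intro mult_mono) auto
  qed
  finally have *: "cell_defect \<tau> X a n s \<le> \<tau>\<^sup>2 / 8 * ip (a 0) (a 0) + 1 / 16 * (D\<^sup>2 * exp (2 * l * t))"
    unfolding cell_defect_def right_diff_distrib[of "\<tau>\<^sup>2 / 8"] by linarith
  have "(\<tau> * nrm (a 0))\<^sup>2 \<le> D\<^sup>2"
    using r(1) l mult_right_mono[of 1 "exp (l * \<tau>)" "nrm (a 0)"]
    by (intro power_mono) (auto simp: D_def intro!: mult_right_mono)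
  also have "\<dots> \<le> D\<^sup>2 * exp (2 * l * t)"
    using l t0 by (simp add: mult_le_cancel_left1)
  finally have "\<tau>\<^sup>2 / 8 * ip (a 0) (a 0) \<le> 1 / 8 * (D\<^sup>2 * exp (2 * l * t))"
    by (simp add: power_mult_distrib nrm_square)
  with * show ?thesis by (simp add: s_def D_def)
qed

lemma pw_linear_mem:
  "trap_run l \<tau> X a \<Longrightarrow> pw_linear \<tau> X t \<in> S"
  by (simp add: pw_linear_def Let_def trap_runD(3))

text \<open>The derivative of the squared distance of two interpolants splits into one defect rate for
  each scheme: testing the variational inequality of one scheme with the interpolant of the other
  makes the values of \<open>f\<close> at the two interpolants cancel.\<close>

lemma trap_run_rate:
  fixes X Y a b i j t \<tau> \<eta>
  defines "dX \<equiv> X (Suc i) - X i" and "dY \<equiv> Y (Suc j) - Y j"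
    and "s \<equiv> t / \<tau> - real i" and "r \<equiv> t / \<eta> - real j"
  defines "e \<equiv> (X i + s *\<^sub>R dX) - (Y j + r *\<^sub>R dY)"
  assumes X: "trap_run l \<tau> X a" and Y: "trap_run l \<eta> Y b" and l: "0 \<le> l"
    and t: "real i * \<tau> \<le> t" "t \<le> real (Suc i) * \<tau>" "real j * \<eta> \<le> t" "t \<le> real (Suc j) * \<eta>"
    and D: "\<tau> * exp (l * \<tau>) * nrm (a 0) + \<eta> * exp (l * \<eta>) * nrm (b 0) \<le> D"
  shows "2 * ip e ((1 / \<tau>) *\<^sub>R dX - (1 / \<eta>) *\<^sub>R dY)
      - 2 * ((1/2 - s) * (f (X i) - f (X (Suc i))) - s / 2 * ip (a i) dX + (1 - s) / 2 * ip (a (Suc i)) dX)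
      - 2 * ((1/2 - r) * (f (Y j) - f (Y (Suc j))) - r / 2 * ip (b j) dY + (1 - r) / 2 * ip (b (Suc j)) dY)
    \<le> 2 * mu * ip e e + mu * (D * exp (l * t)) * nrm e + mu / 2 * (D * exp (l * t))\<^sup>2"
proof -
  note x = trap_runD[OF X] and y = trap_runD[OF Y]
  define w where "w = X i + s *\<^sub>R dX"
  define v where "v = Y j + r *\<^sub>R dY"
  have [simp]: "dX \<in> S" "dY \<in> S" "w \<in> S" "v \<in> S"
    using x(3) y(3) by (auto simp: dX_def dY_def w_def v_def)
  have e: "e = w - v" by (simp add: e_def w_def v_def)
  have s: "0 \<le> s" "s \<le> 1" "0 \<le> r" "r \<le> 1"
    using t x(1) y(1) by (auto simp: s_def r_def field_simps)
  define m where "m = (1/2 - s) * (f (X i) - f (X (Suc i))) - s / 2 * ip (a i) dX + (1 - s) / 2 * ip (a (Suc i)) dX"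
  define k where "k = (1/2 - r) * (f (Y j) - f (Y (Suc j))) - r / 2 * ip (b j) dY + (1 - r) / 2 * ip (b (Suc j)) dY"
  have 1: "ip dX (w - v) / \<tau> \<le> f v - f w + m
     + mu / 2 * ip (w - v) (w - v) + mu / 2 * (nrm dX * nrm (w - v)) + mu / 4 * ip dX dX"
    unfolding m_def
    by (rule trap_step_inequality[OF x(3) x(3) x(4) x(4) _ x(1) s(1,2) x(5) x(6) x(6)])
      (auto simp: dX_def w_def)
  have 2: "ip dY (v - w) / \<eta> \<le> f w - f v + k
     + mu / 2 * ip (v - w) (v - w) + mu / 2 * (nrm dY * nrm (v - w)) + mu / 4 * ip dY dY"
    unfolding k_def
    by (rule trap_step_inequality[OF y(3) y(3) y(4) y(4) _ y(1) s(3,4) y(5) y(6) y(6)])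
      (auto simp: dY_def v_def)
  have sw: "nrm (v - w) = nrm (w - v)" by (rule nrm_minus_commute) auto
  have sw2: "ip (v - w) (v - w) = ip (w - v) (w - v)"
    using sw nrm_square by metis
  have 3: "ip dX (w - v) / \<tau> + ip dY (v - w) / \<eta> = ip (w - v) ((1 / \<tau>) *\<^sub>R dX - (1 / \<eta>) *\<^sub>R dY)"
    by (simp add: ip_linear ip_commute[of _ w] ip_commute[of _ v] diff_divide_distrib)
  have nX: "nrm dX \<le> \<tau> * exp (l * \<tau>) * nrm (a 0) * exp (l * t)"
    unfolding dX_def by (rule trap_run_increment_le_exp[OF X l t(1)])
  have nY: "nrm dY \<le> \<eta> * exp (l * \<eta>) * nrm (b 0) * exp (l * t)"
    unfolding dY_def by (rule trap_run_increment_le_exp[OF Y l t(3)])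
  have "nrm dX + nrm dY \<le> (\<tau> * exp (l * \<tau>) * nrm (a 0) + \<eta> * exp (l * \<eta>) * nrm (b 0)) * exp (l * t)"
    using nX nY by (simp add: distrib_right)
  also have "\<dots> \<le> D * exp (l * t)"
    using D by (intro mult_right_mono) auto
  finally have n: "nrm dX + nrm dY \<le> D * exp (l * t)" .
  \<comment> \<open>Bounding the sum of squares by the square of the sum lets the single quantity
    \<open>D\<close> control both the linear and the quadratic increment terms.\<close>
  have "ip dX dX + ip dY dY \<le> (nrm dX + nrm dY)\<^sup>2"
    by (simp add: power2_sum nrm_square)
  also have "\<dots> \<le> (D * exp (l * t))\<^sup>2"
    using n by (intro power_mono) auto
  finally have "mu / 2 * (ip dX dX + ip dY dY) \<le> mu / 2 * (D * exp (l * t))\<^sup>2"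
    using mu_nonneg by (intro mult_left_mono) auto
  moreover have "mu * ((nrm dX + nrm dY) * nrm e) \<le> mu * ((D * exp (l * t)) * nrm e)"
    using mu_nonneg n by (intro mult_left_mono mult_right_mono) auto
  ultimately show ?thesis
    using 1 2 unfolding m_def[symmetric] k_def[symmetric] 3[symmetric] e sw sw2
    by (simp add: algebra_simps)
qed

lemma cell_defect_sum_le:
  assumes X: "trap_run l \<tau> X a" and Y: "trap_run l \<eta> Y b" and l: "0 \<le> l"
    and t: "real i * \<tau> \<le> t" "t \<le> real (Suc i) * \<tau>" "real j * \<eta> \<le> t" "t \<le> real (Suc j) * \<eta>"
    and D: "\<tau> * exp (l * \<tau>) * nrm (a 0) + \<eta> * exp (l * \<eta>) * nrm (b 0) \<le> D"
  shows "cell_defect \<tau> X a i (t / \<tau> - real i) + cell_defect \<eta> Y b j (t / \<eta> - real j)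
    \<le> 3 / 16 * D\<^sup>2 * exp (2 * l * t)"
proof -
  let ?A = "\<tau> * exp (l * \<tau>) * nrm (a 0)" and ?B = "\<eta> * exp (l * \<eta>) * nrm (b 0)"
  have nn: "0 \<le> ?A" "0 \<le> ?B"
    using trap_runD(1)[OF X] trap_runD(1)[OF Y] by auto
  have "?A\<^sup>2 + ?B\<^sup>2 \<le> (?A + ?B)\<^sup>2"
    using nn by (simp add: power2_sum)
  also have "\<dots> \<le> D\<^sup>2"
    using nn D by (intro power_mono) auto
  finally have "(?A\<^sup>2 + ?B\<^sup>2) * exp (2 * l * t) \<le> D\<^sup>2 * exp (2 * l * t)"
    by (intro mult_right_mono) auto
  with cell_defect_le[OF X l t(1,2)] cell_defect_le[OF Y l t(3,4)] show ?thesis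
    by (simp add: distrib_right)
qed

text \<open>Gronwall's argument for \<open>sqrt (p t)\<close> instead of \<open>p t\<close>, so that
  the terms of order \<open>mu\<close> contribute linearly in time. The shift is 11/8 = 1 + 2 *
  3/16: the two defects together can lower \<open>p\<close> by 3/8 of \<open>D\<^sup>2\<close>, and
  one \<open>D\<^sup>2\<close> must survive.\<close>

lemma trap_runs_distance:
  assumes X: "trap_run l \<tau> X a" and Y: "trap_run l \<eta> Y b" and l: "mu \<le> l" and T: "0 \<le> T"
    and D: "\<tau> * exp (l * \<tau>) * nrm (a 0) + \<eta> * exp (l * \<eta>) * nrm (b 0) \<le> D" "0 < D"
  shows "nrm (pw_linear \<tau> X T - pw_linear \<eta> Y T)
    \<le> exp (l * T) * (nrm (X 0 - Y 0) + 6 / 5 * D + 9 / 8 * l * D * T)"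
proof -
  have l0: "0 \<le> l" using l mu_nonneg by simp
  note x = trap_runD[OF X] and y = trap_runD[OF Y]
  define E where "E t = pw_linear \<tau> X t - pw_linear \<eta> Y t" for t
  define N where "N t = ip (E t) (E t) - 2 * defect \<tau> X a t - 2 * defect \<eta> Y b t" for t
  \<comment> \<open>The added constant keeps \<open>p\<close> above \<open>D\<^sup>2\<close>, so that \<open>sqrt \<circ> p\<close> is differentiable and grows at
    most linearly.\<close>
  define p where "p t = exp (- (2 * l * t)) * N t + 11 / 8 * D\<^sup>2" for t
  have p_ge: "exp (- (2 * l * t)) * ip (E t) (E t) + D\<^sup>2 \<le> p t" if t: "0 \<le> t" for t
  proof -
    obtain i where i: "real i * \<tau> \<le> t" "t < real (Suc i) * \<tau>"
      using grid_cell_right[OF x(1) t] by metis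
    obtain j where j: "real j * \<eta> \<le> t" "t < real (Suc j) * \<eta>"
      using grid_cell_right[OF y(1) t] by metis
    have "ip (E t) (E t) - 3 / 8 * D\<^sup>2 * exp (2 * l * t) \<le> N t"
      using cell_defect_sum_le[OF X Y l0 i(1) _ j(1) _ D(1)] i j
      unfolding N_def by (simp add: defect_cell[OF X] defect_cell[OF Y])
    then have "exp (- (2 * l * t)) * (ip (E t) (E t) - 3 / 8 * D\<^sup>2 * exp (2 * l * t)) \<le> exp (- (2 * l * t)) * N t"
      by (intro mult_left_mono) auto
    moreover have "exp (- (2 * l * t)) * (ip (E t) (E t) - 3 / 8 * D\<^sup>2 * exp (2 * l * t))
        = exp (- (2 * l * t)) * ip (E t) (E t) - 3 / 8 * D\<^sup>2"
      by (simp add: right_diff_distrib exp_minus)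
    ultimately show ?thesis unfolding p_def by linarith
  qed
  have "sqrt (p T) - sqrt (p 0) \<le> 9 / 8 * l * D * T"
  proof (rule increment_le_from_grid_cells[OF x(1) y(1) T])
    fix i j s0 t0
    assume c: "real i * \<tau> \<le> s0" "real j * \<eta> \<le> s0" "s0 \<le> t0"
      "t0 \<le> real (Suc i) * \<tau>" "t0 \<le> real (Suc j) * \<eta>"
    define dX where "dX = X (Suc i) - X i"
    define dY where "dY = Y (Suc j) - Y j"
    have [simp]: "dX \<in> S" "dY \<in> S" "X i \<in> S" "Y j \<in> S" using x(3) y(3) by (auto simp: dX_def dY_def)
    define u where "u = (X i - real i *\<^sub>R dX) - (Y j - real j *\<^sub>R dY)"
    define v where "v = (1 / \<tau>) *\<^sub>R dX - (1 / \<eta>) *\<^sub>R dY"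
    have [simp]: "u \<in> S" "v \<in> S" by (auto simp: u_def v_def)
    \<comment> \<open>Within a common cell, \<open>n\<close> and \<open>q\<close> are given by one
      smooth formula on the whole line, so two-sided derivatives exist even at the ends of the cell,
      where \<open>N\<close> and \<open>p\<close> may have corners.\<close>
    define n where "n t = ip u u + 2 * t * ip u v + t\<^sup>2 * ip v v
       - 2 * cell_defect \<tau> X a i (t / \<tau> - real i) - 2 * cell_defect \<eta> Y b j (t / \<eta> - real j)" for t
    define q where "q t = exp (- (2 * l * t)) * n t + 11 / 8 * D\<^sup>2" for t
    have E: "E t = u + t *\<^sub>R v" "E t = (X i + (t / \<tau> - real i) *\<^sub>R dX) - (Y j + (t / \<eta> - real j) *\<^sub>R dY)"
      and p: "p t = q t" and N: "N t = n t" if "s0 \<le> t" "t \<le> t0" for t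
    proof -
      show 2: "E t = (X i + (t / \<tau> - real i) *\<^sub>R dX) - (Y j + (t / \<eta> - real j) *\<^sub>R dY)"
        using c that by (simp add: E_def dX_def dY_def pw_linear_cell[OF x(1), of i] pw_linear_cell[OF y(1), of j])
      then show 1: "E t = u + t *\<^sub>R v"
        by (simp add: u_def v_def algebra_simps)
      show "N t = n t"
        using c that unfolding N_def n_def 1
        by (simp add: ip_affine_square defect_cell[OF X, of i] defect_cell[OF Y, of j])
      then show "p t = q t"
        by (simp add: p_def q_def)
    qed
    have deriv: "\<exists>z. ((\<lambda>t. sqrt (q t) - 9 / 8 * l * D * t) has_real_derivative z) (at t) \<and> z \<le> 0"
      if t: "s0 \<le> t" "t \<le> t0" for t
    proof -
      have t': "real i * \<tau> \<le> t" "t \<le> real (Suc i) * \<tau>" "real j * \<eta> \<le> t" "t \<le> real (Suc j) * \<eta>"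
        using c t by auto
      have "0 \<le> t"
        using t'(1) x(1) by (meson less_imp_le mult_nonneg_nonneg of_nat_0_le_iff order_trans)
      define mX where "mX = (1/2 - (t / \<tau> - real i)) * (f (X i) - f (X (Suc i)))
        - (t / \<tau> - real i) / 2 * ip (a i) dX + (1 - (t / \<tau> - real i)) / 2 * ip (a (Suc i)) dX"
      define mY where "mY = (1/2 - (t / \<eta> - real j)) * (f (Y j) - f (Y (Suc j)))
        - (t / \<eta> - real j) / 2 * ip (b j) dY + (1 - (t / \<eta> - real j)) / 2 * ip (b (Suc j)) dY"
      define n' where "n' = 2 * ip (E t) v - 2 * mX - 2 * mY"
      have "((\<lambda>t. cell_defect \<tau> X a i (t / \<tau> - real i)) has_real_derivative mX) (at t)"
        unfolding mX_def dX_def by (rule cell_defect_has_derivative) (use x(1) in auto)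
      moreover have "((\<lambda>t. cell_defect \<eta> Y b j (t / \<eta> - real j)) has_real_derivative mY) (at t)"
        unfolding mY_def dY_def by (rule cell_defect_has_derivative) (use y(1) in auto)
      ultimately have "(n has_real_derivative n') (at t)"
        unfolding n_def[abs_def] n'_def
        by (auto intro!: derivative_eq_intros simp: E(1)[OF t] ip_linear)
      then have q': "(q has_real_derivative exp (- (2 * l * t)) * (n' - 2 * l * n t)) (at t)"
        unfolding q_def[abs_def] by (auto intro!: derivative_eq_intros simp: algebra_simps)
      define g where "g = exp (- (l * t)) * nrm (E t)"
      have K: "exp (- (2 * l * t)) = exp (- (l * t)) * exp (- (l * t))" by (simp flip: exp_add)
      have gg: "g * g = exp (- (2 * l * t)) * ip (E t) (E t)"
        using nrm_square[of "E t"] by (simp add: g_def K power2_eq_square)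
      have q_ge: "g * g + D\<^sup>2 \<le> q t"
        using p_ge[OF \<open>0 \<le> t\<close>] by (simp add: gg p[OF t])
      have "0 < D\<^sup>2" using D by simp
      then have qpos: "0 < q t" using q_ge by (smt (verit) zero_le_square)
      have "g * g \<le> q t" "D\<^sup>2 \<le> q t"
        using q_ge \<open>0 < D\<^sup>2\<close> by (auto simp: add_increasing intro: order.trans[rotated])
      then have sg: "g \<le> sqrt (q t)" and sD: "D \<le> sqrt (q t)"
        by (auto intro: real_le_rsqrt simp: power2_eq_square)
      have "n' \<le> 2 * mu * ip (E t) (E t) + mu * (D * exp (l * t)) * nrm (E t) + mu / 2 * (D * exp (l * t))\<^sup>2"
        using trap_run_rate[OF X Y l0 t' D(1)]
        unfolding n'_def mX_def mY_def v_def E(2)[OF t] dX_def dY_def .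
      then have "exp (- (2 * l * t)) * n' \<le> exp (- (2 * l * t)) *
          (2 * mu * ip (E t) (E t) + mu * (D * exp (l * t)) * nrm (E t) + mu / 2 * (D * exp (l * t))\<^sup>2)"
        by (intro mult_left_mono) auto
      also have "\<dots> = 2 * mu * (g * g) + mu * (D * g) + mu / 2 * (D * D)"
      proof -
        have e1: "exp (l * t) * exp (- (l * t)) = 1" by (simp flip: exp_add)
        then have ex: "exp (l * t) * (exp (- (l * t)) * z) = z" for z
          by (metis mult.assoc mult_1)
        show ?thesis
          unfolding gg unfolding g_def K power2_eq_square
          by (simp add: distrib_left mult_ac ex e1)
      qed
      also have "\<dots> \<le> 2 * l * (g * g) + l * (D * g) + l / 2 * (D * D)"
        using l D(2) by (intro add_mono mult_right_mono) (auto simp: g_def)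
      finally have n'_le: "exp (- (2 * l * t)) * n' \<le> 2 * l * (g * g) + l * (D * g) + l / 2 * (D * D)" .
      have kn: "exp (- (2 * l * t)) * n t = q t - 11 / 8 * (D * D)"
        by (simp add: q_def power2_eq_square)
      have "l * (g * g) \<le> l * (q t - D * D)"
        using q_ge l0 by (intro mult_left_mono) (auto simp: power2_eq_square)
      moreover have "exp (- (2 * l * t)) * (n' - 2 * l * n t)
          = exp (- (2 * l * t)) * n' - 2 * (l * (exp (- (2 * l * t)) * n t))"
        by (simp only: right_diff_distrib mult_ac)
      moreover have "l * (q t - D * D) = l * q t - l * (D * D)"
        "l * (exp (- (2 * l * t)) * n t) = l * q t - 11 / 8 * (l * (D * D))"
        unfolding kn by (simp_all only: right_diff_distrib mult_ac)
      \<comment> \<open>The quadratic growth cancels against the derivative of the weight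
        \<open>exp (- (2 * l * t))\<close>. What is left is 5/4 = 1/2 + 2 * (11/8 - 1).\<close>
      ultimately have "exp (- (2 * l * t)) * (n' - 2 * l * n t) \<le> l * (D * g) + 5 / 4 * (l * (D * D))"
        using n'_le by linarith
      \<comment> \<open>Both \<open>g\<close> and \<open>D\<close> are at most
        \<open>sqrt (q t)\<close>, so one factor \<open>sqrt (q t)\<close> splits off and cancels in
        the derivative of the square root; 9/8 is half of 1 + 5/4.\<close>
      also have "\<dots> \<le> l * (D * sqrt (q t)) + 5 / 4 * (l * (D * sqrt (q t)))"
        using l0 D(2) sg sD by (intro add_mono mult_left_mono) auto
      finally have q'_le: "exp (- (2 * l * t)) * (n' - 2 * l * n t) \<le> 9 / 4 * l * D * sqrt (q t)"
        by (simp add: mult_ac)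
      have "((\<lambda>t. sqrt (q t) - 9 / 8 * l * D * t) has_real_derivative
          inverse (sqrt (q t)) / 2 * (exp (- (2 * l * t)) * (n' - 2 * l * n t)) - 9 / 8 * l * D) (at t)"
        by (rule derivative_eq_intros DERIV_chain2[OF DERIV_real_sqrt[OF qpos] q'] refl | simp)+
      moreover have "inverse (sqrt (q t)) / 2 * (exp (- (2 * l * t)) * (n' - 2 * l * n t)) - 9 / 8 * l * D \<le> 0"
        using q'_le qpos by (simp add: divide_simps mult_ac)
      ultimately show ?thesis by blast
    qed
    have "sqrt (q t0) - 9 / 8 * l * D * t0 \<le> sqrt (q s0) - 9 / 8 * l * D * s0"
      by (rule DERIV_nonpos_imp_nonincreasing[OF c(3) deriv])
    then show "sqrt (p t0) - sqrt (p s0) \<le> 9 / 8 * l * D * (t0 - s0)"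
      using p[of s0] p[of t0] c(3) by (simp add: algebra_simps)
  qed
  moreover have "sqrt (p 0) \<le> nrm (X 0 - Y 0) + 6 / 5 * D"
  proof (rule real_le_lsqrt)
    have "p 0 = (nrm (X 0 - Y 0))\<^sup>2 + 11 / 8 * D\<^sup>2"
      by (simp add: p_def N_def E_def pw_linear_def defect_def cell_defect_def nrm_square)
    \<comment> \<open>6/5 is a rational upper bound of the square root of 11/8.\<close>
    also have "\<dots> \<le> (nrm (X 0 - Y 0))\<^sup>2 + 2 * (nrm (X 0 - Y 0) * (6 / 5 * D)) + (6 / 5 * D)\<^sup>2"
      by (simp add: power2_eq_square)
        (use mult_nonneg_nonneg[OF nrm_nonneg[of "X 0 - Y 0"] less_imp_le[OF D(2)]] zero_le_square[of D] in linarith)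
    also have "\<dots> = (nrm (X 0 - Y 0) + 6 / 5 * D)\<^sup>2"
      by (simp add: power2_sum)
    finally show "p 0 \<le> (nrm (X 0 - Y 0) + 6 / 5 * D)\<^sup>2" .
  qed (use D(2) in auto)
  moreover have "exp (- (l * T)) * nrm (E T) \<le> sqrt (p T)"
  proof (rule real_le_rsqrt)
    have "(exp (- (l * T)) * nrm (E T))\<^sup>2 = exp (- (2 * l * T)) * ip (E T) (E T)"
      by (simp add: power_mult_distrib nrm_square flip: exp_double)
    also have "\<dots> \<le> p T"
      using p_ge[OF T] zero_le_power2[of D] by linarith
    finally show "(exp (- (l * T)) * nrm (E T))\<^sup>2 \<le> p T" .
  qed
  ultimately have "exp (- (l * T)) * nrm (E T) \<le> nrm (X 0 - Y 0) + 6 / 5 * D + 9 / 8 * l * D * T"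
    by linarith
  then have "exp (l * T) * (exp (- (l * T)) * nrm (E T))
      \<le> exp (l * T) * (nrm (X 0 - Y 0) + 6 / 5 * D + 9 / 8 * l * D * T)"
    by (intro mult_left_mono) auto
  moreover have "exp (l * T) * (exp (- (l * T)) * nrm (E T)) = nrm (E T)"
    by (simp add: exp_minus)
  ultimately show ?thesis unfolding E_def by linarith
qed

text \<open>Runs with different steps come with different rates; this allows them to be compared
  under a common larger one.\<close>

lemma trap_run_mono_rate:
  assumes "trap_run l \<tau> X a" "l \<le> l'"
  shows "trap_run l' \<tau> X a"
proof -
  have "exp (l * (real n * \<tau>)) * nrm (a 0) \<le> exp (l' * (real n * \<tau>)) * nrm (a 0)" for n
    using trap_runD(1)[OF assms(1)] assms(2) by (intro mult_right_mono) (auto intro!: mult_right_mono)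
  then show ?thesis
    using assms(1) unfolding trap_run_def by (meson order_trans)
qed

section \<open>Piecewise constant interpolants and their limit\<close>

lemma interp_mem: "trap_run l \<tau> X a \<Longrightarrow> interp X \<tau> t \<in> S"
  by (simp add: interp_def trap_runD(3))

lemma interp_pw_linear_distance:
  assumes run: "trap_run l \<tau> X a" and l: "0 \<le> l" and t: "0 \<le> t"
  shows "nrm (pw_linear \<tau> X t - interp X \<tau> t) \<le> \<tau> * exp (l * \<tau>) * nrm (a 0) * exp (l * t)"
proof -
  note r = trap_runD[OF run]
  obtain n where n: "n = nat \<lfloor>t / \<tau>\<rfloor>" "real n * \<tau> \<le> t" "t < real (Suc n) * \<tau>"
    using grid_cell_right[OF r(1) t] .
  have s: "0 \<le> t / \<tau> - real n" "t / \<tau> - real n \<le> 1"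
    using n(2,3) r(1) by (auto simp: field_simps)
  have "nrm (pw_linear \<tau> X t - interp X \<tau> t) = \<bar>t / \<tau> - real n\<bar> * nrm (X (Suc n) - X n)"
    using r(3) by (simp add: pw_linear_def interp_def Let_def nrm_scale flip: n(1))
  also have "\<dots> \<le> 1 * nrm (X (Suc n) - X n)"
    using s by (intro mult_right_mono) auto
  finally show ?thesis
    using trap_run_increment_le_exp[OF run l n(2)] by simp
qed

text \<open>Passing from linear to constant interpolants costs at most one increment per scheme,
  together \<open>D * exp (l * t)\<close>; hence 11/5 = 6/5 + 1.\<close>

lemma trap_runs_interp_distance:
  assumes X: "trap_run l \<tau> X a" and Y: "trap_run l \<eta> Y b" and l: "mu \<le> l" and t: "0 \<le> t"
    and D: "\<tau> * exp (l * \<tau>) * nrm (a 0) + \<eta> * exp (l * \<eta>) * nrm (b 0) \<le> D" "0 < D"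
  shows "nrm (interp X \<tau> t - interp Y \<eta> t)
    \<le> exp (l * t) * (nrm (X 0 - Y 0) + (11 / 5 + 9 / 8 * l * t) * D)"
proof -
  have l0: "0 \<le> l" using l mu_nonneg by simp
  note mem = interp_mem[OF X, of t] interp_mem[OF Y, of t] pw_linear_mem[OF X, of t] pw_linear_mem[OF Y, of t]
  have "nrm (interp X \<tau> t - interp Y \<eta> t) \<le> nrm (interp X \<tau> t - pw_linear \<tau> X t)
      + (nrm (pw_linear \<tau> X t - pw_linear \<eta> Y t) + nrm (pw_linear \<eta> Y t - interp Y \<eta> t))"
    using nrm_triangle_diff[of "interp X \<tau> t" "pw_linear \<tau> X t" "interp Y \<eta> t"]
      nrm_triangle_diff[of "pw_linear \<tau> X t" "pw_linear \<eta> Y t" "interp Y \<eta> t"] mem by simp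
  also have "nrm (interp X \<tau> t - pw_linear \<tau> X t) \<le> \<tau> * exp (l * \<tau>) * nrm (a 0) * exp (l * t)"
    using interp_pw_linear_distance[OF X l0 t] nrm_minus_commute[of "interp X \<tau> t" "pw_linear \<tau> X t"] mem by simp
  also have "nrm (pw_linear \<eta> Y t - interp Y \<eta> t) \<le> \<eta> * exp (l * \<eta>) * nrm (b 0) * exp (l * t)"
    by (rule interp_pw_linear_distance[OF Y l0 t])
  also have "nrm (pw_linear \<tau> X t - pw_linear \<eta> Y t)
      \<le> exp (l * t) * (nrm (X 0 - Y 0) + 6 / 5 * D + 9 / 8 * l * D * t)"
    by (rule trap_runs_distance[OF X Y l t D])
  finally have "nrm (interp X \<tau> t - interp Y \<eta> t) \<le> exp (l * t) * (nrm (X 0 - Y 0) + 6 / 5 * D + 9 / 8 * l * D * t)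
      + (\<tau> * exp (l * \<tau>) * nrm (a 0) + \<eta> * exp (l * \<eta>) * nrm (b 0)) * exp (l * t)"
    by (simp add: algebra_simps)
  also have "\<dots> \<le> exp (l * t) * (nrm (X 0 - Y 0) + 6 / 5 * D + 9 / 8 * l * D * t) + D * exp (l * t)"
    using D(1) by (intro add_left_mono mult_right_mono) auto
  also have "\<dots> = exp (l * t) * (nrm (X 0 - Y 0) + (11 / 5 + 9 / 8 * l * t) * D)"
    by (simp add: algebra_simps)
  finally show ?thesis .
qed

text \<open>The summand \<open>\<tau>\<close> accounts for the jumps of the step function; it
  disappears in the limit and leaves a genuine Lipschitz bound.\<close>

lemma trap_run_lipschitz:
  assumes run: "trap_run l \<tau> X a" and l: "0 \<le> l" and st: "0 \<le> s" "s \<le> t"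
  shows "nrm (interp X \<tau> t - interp X \<tau> s) \<le> (t - s + \<tau>) * (exp (l * t) * nrm (a 0))"
proof -
  note r = trap_runD[OF run]
  have t: "0 \<le> t" using st by simp
  obtain n where n: "n = nat \<lfloor>s / \<tau>\<rfloor>" "real n * \<tau> \<le> s" "s < real (Suc n) * \<tau>"
    using grid_cell_right[OF r(1) st(1)] .
  obtain m where m: "m = nat \<lfloor>t / \<tau>\<rfloor>" "real m * \<tau> \<le> t" "t < real (Suc m) * \<tau>"
    using grid_cell_right[OF r(1) t] .
  have "n \<le> m"
    unfolding n(1) m(1) using st r(1) by (intro nat_mono floor_mono divide_right_mono) auto
  then have "real m * \<tau> \<le> t \<longrightarrow> nrm (X m - X n) \<le> (real m - real n) * \<tau> * (exp (l * t) * nrm (a 0))"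
  proof (induction rule: dec_induct)
    case base
    then show ?case using nrm_scale[of "X n" 0] r(3) by simp
  next
    case (step k)
    show ?case
    proof
      assume k: "real (Suc k) * \<tau> \<le> t"
      then have "real k * \<tau> \<le> t" using r(1) by (simp add: algebra_simps)
      with step.IH have IH: "nrm (X k - X n) \<le> (real k - real n) * \<tau> * (exp (l * t) * nrm (a 0))" by simp
      have "nrm (X (Suc k) - X k) \<le> \<tau> * exp (l * (real (Suc k) * \<tau>)) * nrm (a 0)"
        by (rule trap_run_increment_le[OF run l])
      also have "\<dots> \<le> \<tau> * exp (l * t) * nrm (a 0)"
        using k l r(1) by (intro mult_right_mono mult_left_mono) (auto intro!: mult_left_mono)
      finally have "nrm (X (Suc k) - X n) \<le> \<tau> * exp (l * t) * nrm (a 0)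
          + (real k - real n) * \<tau> * (exp (l * t) * nrm (a 0))"
        using nrm_triangle_diff[of "X (Suc k)" "X k" "X n"] r(3) IH by simp
      then show "nrm (X (Suc k) - X n) \<le> (real (Suc k) - real n) * \<tau> * (exp (l * t) * nrm (a 0))"
        by (simp add: algebra_simps)
    qed
  qed
  then have "nrm (X m - X n) \<le> (real m - real n) * \<tau> * (exp (l * t) * nrm (a 0))"
    using m(2) by blast
  also have "\<dots> \<le> (t - s + \<tau>) * (exp (l * t) * nrm (a 0))"
    using n m by (intro mult_right_mono) (auto simp: algebra_simps)
  finally show ?thesis by (simp add: interp_def n(1) m(1))
qed

text \<open>Along one sequence of steps tending to 0 the interpolants are Cauchy at each time, which
  defines the limit. The error estimate then holds for every admissible step, so the whole family
  converges to this limit.\<close>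

theorem trap_runs_converge:
  assumes complete: "\<And>x :: nat \<Rightarrow> 'v. \<lbrakk>\<And>n. x n \<in> S; \<And>\<epsilon>. 0 < \<epsilon> \<Longrightarrow> \<exists>N. \<forall>m\<ge>N. \<forall>n\<ge>N. nrm (x m - x n) \<le> \<epsilon>\<rbrakk>
      \<Longrightarrow> \<exists>z\<in>S. (\<lambda>n. nrm (x n - z)) \<longlonglongrightarrow> 0"
    and Ts: "Ts \<subseteq> {0<..}" "0 islimpt Ts"
    and run: "\<And>\<tau>. \<tau> \<in> Ts \<Longrightarrow> trap_run (l \<tau>) \<tau> (X \<tau>) (a \<tau>)"
    and l: "\<And>\<tau>. \<tau> \<in> Ts \<Longrightarrow> mu \<le> l \<tau>" and l_mono: "\<And>\<eta> \<tau>. \<eta> \<in> Ts \<Longrightarrow> \<tau> \<in> Ts \<Longrightarrow> \<eta> \<le> \<tau> \<Longrightarrow> l \<eta> \<le> l \<tau>"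
    and x0: "x0 \<in> S" and init: "((\<lambda>\<tau>. nrm (X \<tau> 0 - x0)) \<longlongrightarrow> 0) (at 0 within Ts)"
    and B: "\<And>\<tau>. \<tau> \<in> Ts \<Longrightarrow> nrm (a \<tau> 0) \<le> B"
  shows "\<exists>Z. (\<forall>t\<ge>0. Z t \<in> S) \<and>
    (\<forall>T\<ge>0. \<exists>L. \<forall>s\<in>{0..T}. \<forall>t\<in>{0..T}. nrm (Z s - Z t) \<le> L * \<bar>s - t\<bar>) \<and>
    (\<forall>T>0. \<forall>\<epsilon>>0. \<forall>\<^sub>F \<tau> in at 0 within Ts. \<forall>t\<in>{0..T}. nrm (Z t - interp (X \<tau>) \<tau> t) \<le> \<epsilon>) \<and>
    (\<forall>t\<ge>0. \<forall>\<tau>\<in>Ts. nrm (Z t - interp (X \<tau>) \<tau> t) \<le> exp (l \<tau> * t) *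
       (nrm (X \<tau> 0 - x0) + (11 / 5 + 9 / 8 * l \<tau> * t) * (\<tau> * exp (l \<tau> * \<tau>) * nrm (a \<tau> 0))))"
proof -
  obtain \<tau>0 where \<tau>0: "\<tau>0 \<in> Ts" using Ts(2) islimpt_def[of 0 Ts] by (metis open_UNIV UNIV_I)
  \<comment> \<open>By monotonicity of \<open>l\<close>, the constant \<open>L\<close> dominates the
    rates of all steps up to \<tau>0, and only those matter for the limit.\<close>
  define L where "L = l \<tau>0"
  have L: "mu \<le> L" "0 \<le> L" using l[OF \<tau>0] mu_nonneg by (auto simp: L_def)
  have B0: "0 \<le> B" using B[OF \<tau>0] nrm_nonneg order_trans by blast
  obtain \<eta> where \<eta>: "\<And>k. \<eta> k \<in> Ts" "\<And>k. \<eta> k \<noteq> 0" "\<eta> \<longlonglongrightarrow> 0"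
    using Ts(2) unfolding islimpt_sequential by blast
  define r where "r \<tau> = nrm (X \<tau> 0 - x0)" for \<tau>
  \<comment> \<open>The extra \<open>\<tau>\<close> keeps the bound strictly positive even if all
    initial gradients vanish, since the comparison of two runs asks for
    \<open>0 < D\<close>.\<close>
  define c where "c \<tau> = \<tau> * exp (L * \<tau>) * B + \<tau>" for \<tau>
  have pos: "0 < \<tau>" if "\<tau> \<in> Ts" for \<tau> using Ts(1) that by auto
  have memX: "X \<tau> 0 \<in> S" if "\<tau> \<in> Ts" for \<tau> using trap_runD(3)[OF run[OF that]] .
  have mem: "interp (X \<tau>) \<tau> t \<in> S" if "\<tau> \<in> Ts" for \<tau> t using interp_mem[OF run[OF that]] .
  have r\<eta>: "(\<lambda>k. r (\<eta> k)) \<longlonglongrightarrow> 0"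
    using init unfolding r_def
    by (rule filterlim_compose) (auto simp: filterlim_at \<eta>)
  have c_lim: "(c \<longlongrightarrow> 0) (at 0 within A)" for A
    unfolding c_def[abs_def] by (auto intro!: tendsto_eq_intros)
  have c\<eta>: "(\<lambda>k. c (\<eta> k)) \<longlonglongrightarrow> 0"
    by (rule filterlim_compose[OF c_lim[of UNIV]]) (auto simp: filterlim_at \<eta>)
  have small: "\<forall>\<^sub>F k in sequentially. \<eta> k \<le> \<tau>" if "\<tau> \<in> Ts" for \<tau>
    using order_tendstoD(2)[OF \<eta>(3) pos[OF that]] by eventually_elim simp
  have bound: "nrm (interp (X \<tau>) \<tau> t - interp (X \<sigma>) \<sigma> t)
      \<le> exp (l' * t) * (r \<tau> + r \<sigma> + (11 / 5 + 9 / 8 * l' * t) * D)"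
    if "\<tau> \<in> Ts" "\<sigma> \<in> Ts" "l \<tau> \<le> l'" "l \<sigma> \<le> l'" "0 \<le> t" "0 < D"
      "\<tau> * exp (l' * \<tau>) * nrm (a \<tau> 0) + \<sigma> * exp (l' * \<sigma>) * nrm (a \<sigma> 0) \<le> D"
    for \<tau> \<sigma> l' t D
  proof -
    have "nrm (interp (X \<tau>) \<tau> t - interp (X \<sigma>) \<sigma> t)
        \<le> exp (l' * t) * (nrm (X \<tau> 0 - X \<sigma> 0) + (11 / 5 + 9 / 8 * l' * t) * D)"
      using that l[of \<tau>]
      by (intro trap_runs_interp_distance[OF trap_run_mono_rate[OF run] trap_run_mono_rate[OF run]]) auto
    also have "nrm (X \<tau> 0 - X \<sigma> 0) \<le> r \<tau> + r \<sigma>"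
      using nrm_triangle_diff[of "X \<tau> 0" x0 "X \<sigma> 0"] nrm_minus_commute[of x0 "X \<sigma> 0"] memX that(1,2) x0
      by (simp add: r_def)
    finally show ?thesis by simp
  qed
  have c_ge: "\<tau> * exp (l' * \<tau>) * nrm (a \<tau> 0) < c \<tau>" if "\<tau> \<in> Ts" "l' \<le> L" for \<tau> l'
  proof -
    have "\<tau> * exp (l' * \<tau>) * nrm (a \<tau> 0) \<le> \<tau> * exp (L * \<tau>) * B"
      using pos[OF that(1)] that(2) B[OF that(1)] by (intro mult_mono) auto
    then show ?thesis using pos[OF that(1)] unfolding c_def by linarith
  qed
  have c_pos: "0 < c \<tau>" if "\<tau> \<in> Ts" for \<tau>
    using pos[OF that] B0 by (auto simp: c_def intro!: add_nonneg_pos)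
  \<comment> \<open>The bracket in \<open>K t\<close> is at least 1, so one factor serves for the
    initial distances and for the step-size terms.\<close>
  define K where "K t = exp (L * t) * (11 / 5 + 9 / 8 * L * t)" for t
  have K: "exp (L * t) * (p + (11 / 5 + 9 / 8 * L * t) * q) \<le> K t * (p + q)" if "0 \<le> t" "0 \<le> p" for t p q
  proof -
    have "1 * p \<le> (11 / 5 + 9 / 8 * L * t) * p"
      using that L by (intro mult_right_mono) (auto intro: add_increasing2)
    then have "exp (L * t) * (p + (11 / 5 + 9 / 8 * L * t) * q)
        \<le> exp (L * t) * ((11 / 5 + 9 / 8 * L * t) * p + (11 / 5 + 9 / 8 * L * t) * q)"
      by (intro mult_left_mono) auto
    then show ?thesis by (simp only: K_def mult.assoc flip: distrib_left)
  qed
  have K0: "0 \<le> K t" if "0 \<le> t" for t using that L by (simp add: K_def)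
  have "\<exists>z\<in>S. (\<lambda>k. nrm (interp (X (\<eta> k)) (\<eta> k) t - z)) \<longlonglongrightarrow> 0" if t: "0 \<le> t" for t
  proof (rule complete)
    fix \<epsilon> :: real assume "0 < \<epsilon>"
    have "(\<lambda>k. K t * (r (\<eta> k) + c (\<eta> k))) \<longlonglongrightarrow> 0"
      using tendsto_mult_right_zero[OF tendsto_add_zero[OF r\<eta> c\<eta>]] .
    then have "\<forall>\<^sub>F k in sequentially. K t * (r (\<eta> k) + c (\<eta> k)) < \<epsilon> / 2"
      using \<open>0 < \<epsilon>\<close> by (intro order_tendstoD) auto
    with small[OF \<tau>0] have "\<forall>\<^sub>F k in sequentially. K t * (r (\<eta> k) + c (\<eta> k)) < \<epsilon> / 2 \<and> \<eta> k \<le> \<tau>0"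
      by eventually_elim simp
    then obtain N where N: "\<And>k. N \<le> k \<Longrightarrow> K t * (r (\<eta> k) + c (\<eta> k)) < \<epsilon> / 2 \<and> \<eta> k \<le> \<tau>0"
      unfolding eventually_sequentially by blast
    have "nrm (interp (X (\<eta> m)) (\<eta> m) t - interp (X (\<eta> n)) (\<eta> n) t) \<le> \<epsilon>" if "N \<le> m" "N \<le> n" for m n
    proof -
      have lL: "l (\<eta> m) \<le> L" "l (\<eta> n) \<le> L"
        using N that l_mono[OF \<eta>(1) \<tau>0] by (auto simp: L_def)
      have "nrm (interp (X (\<eta> m)) (\<eta> m) t - interp (X (\<eta> n)) (\<eta> n) t)
          \<le> exp (L * t) * (r (\<eta> m) + r (\<eta> n) + (11 / 5 + 9 / 8 * L * t) * (c (\<eta> m) + c (\<eta> n)))"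
        using c_ge[OF \<eta>(1), of L m] c_ge[OF \<eta>(1), of L n] lL t c_pos[OF \<eta>(1)]
        by (intro bound \<eta>) (auto intro: add_pos_pos)
      also have "\<dots> \<le> K t * ((r (\<eta> m) + r (\<eta> n)) + (c (\<eta> m) + c (\<eta> n)))"
        using t by (intro K) (auto simp: r_def)
      also have "\<dots> = K t * (r (\<eta> m) + c (\<eta> m)) + K t * (r (\<eta> n) + c (\<eta> n))"
        by (simp add: algebra_simps)
      also have "\<dots> \<le> \<epsilon>"
        using N[OF that(1)] N[OF that(2)] by linarith
      finally show ?thesis .
    qed
    then show "\<exists>N. \<forall>m\<ge>N. \<forall>n\<ge>N. nrm (interp (X (\<eta> m)) (\<eta> m) t - interp (X (\<eta> n)) (\<eta> n) t) \<le> \<epsilon>"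
      by blast
  qed (rule mem[OF \<eta>(1)])
  then obtain Z where Z: "\<And>t. 0 \<le> t \<Longrightarrow> Z t \<in> S"
    "\<And>t. 0 \<le> t \<Longrightarrow> (\<lambda>k. nrm (interp (X (\<eta> k)) (\<eta> k) t - Z t)) \<longlonglongrightarrow> 0"
    by metis
  have error: "nrm (Z t - interp (X \<tau>) \<tau> t) \<le> exp (l \<tau> * t) *
       (r \<tau> + (11 / 5 + 9 / 8 * l \<tau> * t) * (\<tau> * exp (l \<tau> * \<tau>) * nrm (a \<tau> 0)))"
    if t: "0 \<le> t" and \<tau>: "\<tau> \<in> Ts" for t \<tau>
  proof (rule LIMSEQ_le_const)
    define A where "A = \<tau> * exp (l \<tau> * \<tau>) * nrm (a \<tau> 0)"
    define b where "b k = \<eta> k * exp (l \<tau> * \<eta> k) * B + \<eta> k" for k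
    have "b \<longlonglongrightarrow> 0"
      unfolding b_def[abs_def] by (auto intro!: tendsto_eq_intros \<eta>(3))
    then show "(\<lambda>k. nrm (interp (X (\<eta> k)) (\<eta> k) t - Z t) + exp (l \<tau> * t) *
        (r \<tau> + r (\<eta> k) + (11 / 5 + 9 / 8 * l \<tau> * t) * (A + b k)))
      \<longlonglongrightarrow> exp (l \<tau> * t) * (r \<tau> + (11 / 5 + 9 / 8 * l \<tau> * t) * A)"
      by (auto intro!: tendsto_eq_intros r\<eta> Z(2)[OF t])
    \<comment> \<open>For \<open>\<eta> k \<le> \<tau>\<close> the rate of the finer run is at most
      \<open>l \<tau>\<close>, so the comparison runs at the rate of the coarse scheme itself and
      nothing is lost in the limit. The terms \<open>r (\<eta> k)\<close> and \<open>b k\<close>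
      vanish.\<close>
    have "\<forall>\<^sub>F k in sequentially. nrm (Z t - interp (X \<tau>) \<tau> t) \<le> nrm (interp (X (\<eta> k)) (\<eta> k) t - Z t)
        + exp (l \<tau> * t) * (r \<tau> + r (\<eta> k) + (11 / 5 + 9 / 8 * l \<tau> * t) * (A + b k))"
      using small[OF \<tau>]
    proof eventually_elim
      case (elim k)
      note m = mem[OF \<tau>, of t] mem[OF \<eta>(1), of k t] Z(1)[OF t]
      have "\<eta> k * exp (l \<tau> * \<eta> k) * nrm (a (\<eta> k) 0) \<le> \<eta> k * exp (l \<tau> * \<eta> k) * B"
        using B[OF \<eta>(1)] pos[OF \<eta>(1)] by (intro mult_left_mono) (auto intro: less_imp_le)
      then have "A + \<eta> k * exp (l \<tau> * \<eta> k) * nrm (a (\<eta> k) 0) \<le> A + b k"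
        using pos[OF \<eta>(1), of k] unfolding b_def by linarith
      moreover have "0 < A + b k"
        using pos[OF \<eta>(1), of k] pos[OF \<tau>] B0 by (auto simp: A_def b_def intro!: add_nonneg_pos)
      ultimately have "nrm (interp (X \<tau>) \<tau> t - interp (X (\<eta> k)) (\<eta> k) t)
          \<le> exp (l \<tau> * t) * (r \<tau> + r (\<eta> k) + (11 / 5 + 9 / 8 * l \<tau> * t) * (A + b k))"
        using l_mono[OF \<eta>(1) \<tau> elim] t by (intro bound \<tau> \<eta>) (auto simp: A_def)
      then show ?case
        using nrm_triangle_diff[of "Z t" "interp (X (\<eta> k)) (\<eta> k) t" "interp (X \<tau>) \<tau> t"] m
          nrm_minus_commute[of "Z t" "interp (X (\<eta> k)) (\<eta> k) t"]
          nrm_minus_commute[of "interp (X \<tau>) \<tau> t" "interp (X (\<eta> k)) (\<eta> k) t"] by simp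
    qed
    then show "\<exists>N. \<forall>k\<ge>N. nrm (Z t - interp (X \<tau>) \<tau> t) \<le> nrm (interp (X (\<eta> k)) (\<eta> k) t - Z t)
        + exp (l \<tau> * t) * (r \<tau> + r (\<eta> k) + (11 / 5 + 9 / 8 * l \<tau> * t) * (A + b k))"
      by (simp add: eventually_sequentially)
  qed
  have lip: "nrm (Z t - Z s) \<le> exp (L * t) * B * (t - s)" if st: "0 \<le> s" "s \<le> t" for s t
  proof (rule LIMSEQ_le_const)
    have t: "0 \<le> t" using st by simp
    show "(\<lambda>k. nrm (interp (X (\<eta> k)) (\<eta> k) t - Z t) + ((t - s + \<eta> k) * (exp (L * t) * B)
        + nrm (interp (X (\<eta> k)) (\<eta> k) s - Z s))) \<longlonglongrightarrow> exp (L * t) * B * (t - s)"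
      by (auto intro!: tendsto_eq_intros Z(2) t st(1) \<eta>(3))
    have "\<forall>\<^sub>F k in sequentially. nrm (Z t - Z s) \<le> nrm (interp (X (\<eta> k)) (\<eta> k) t - Z t)
        + ((t - s + \<eta> k) * (exp (L * t) * B) + nrm (interp (X (\<eta> k)) (\<eta> k) s - Z s))"
      using small[OF \<tau>0]
    proof eventually_elim
      case (elim k)
      note m = mem[OF \<eta>(1), of k t] mem[OF \<eta>(1), of k s] Z(1)[OF t] Z(1)[OF st(1)]
      have "trap_run L (\<eta> k) (X (\<eta> k)) (a (\<eta> k))"
        unfolding L_def by (rule trap_run_mono_rate[OF run[OF \<eta>(1)] l_mono[OF \<eta>(1) \<tau>0 elim]])
      from trap_run_lipschitz[OF this L(2) st]
      have "nrm (interp (X (\<eta> k)) (\<eta> k) t - interp (X (\<eta> k)) (\<eta> k) s)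
          \<le> (t - s + \<eta> k) * (exp (L * t) * nrm (a (\<eta> k) 0))" .
      also have "\<dots> \<le> (t - s + \<eta> k) * (exp (L * t) * B)"
        using B[OF \<eta>(1)] pos[OF \<eta>(1), of k] st by (intro mult_left_mono) auto
      finally show ?case
        using nrm_triangle_diff[of "Z t" "interp (X (\<eta> k)) (\<eta> k) t" "Z s"]
          nrm_triangle_diff[of "interp (X (\<eta> k)) (\<eta> k) t" "interp (X (\<eta> k)) (\<eta> k) s" "Z s"]
          nrm_minus_commute[of "Z t" "interp (X (\<eta> k)) (\<eta> k) t"] m by simp
    qed
    then show "\<exists>N. \<forall>k\<ge>N. nrm (Z t - Z s) \<le> nrm (interp (X (\<eta> k)) (\<eta> k) t - Z t)
        + ((t - s + \<eta> k) * (exp (L * t) * B) + nrm (interp (X (\<eta> k)) (\<eta> k) s - Z s))"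
      by (simp add: eventually_sequentially)
  qed
  have lip_T: "nrm (Z s - Z t) \<le> exp (L * T) * B * \<bar>s - t\<bar>" if st: "s \<in> {0..T}" "t \<in> {0..T}" for s t T
  proof -
    have *: "nrm (Z v - Z u) \<le> exp (L * T) * B * \<bar>v - u\<bar>" if "0 \<le> u" "u \<le> v" "v \<le> T" for u v
    proof -
      have "exp (L * v) * B * (v - u) \<le> exp (L * T) * B * (v - u)"
        using that L B0 by (intro mult_right_mono) (auto intro!: mult_left_mono)
      then show ?thesis using lip[OF that(1,2)] that by simp
    qed
    show ?thesis
      using *[of s t] *[of t s] st nrm_minus_commute[of "Z s" "Z t"] Z(1)
      by (cases "s \<le> t") (auto simp: abs_minus_commute)
  qed
  have uniform: "\<forall>\<^sub>F \<tau> in at 0 within Ts. \<forall>t\<in>{0..T}. nrm (Z t - interp (X \<tau>) \<tau> t) \<le> \<epsilon>"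
    if T: "0 < T" and \<epsilon>: "0 < \<epsilon>" for T \<epsilon>
  proof -
    have "((\<lambda>\<tau>. K T * (r \<tau> + c \<tau>)) \<longlongrightarrow> 0) (at 0 within Ts)"
      using tendsto_mult_right_zero[OF tendsto_add_zero[OF init c_lim]] by (simp add: r_def)
    then have "\<forall>\<^sub>F \<tau> in at 0 within Ts. K T * (r \<tau> + c \<tau>) < \<epsilon>"
      using \<epsilon> by (intro order_tendstoD) auto
    moreover have "\<forall>\<^sub>F \<tau> in at 0 within Ts. \<tau> \<in> Ts \<and> \<tau> \<le> \<tau>0"
    proof -
      have "\<forall>\<^sub>F \<tau> in at 0 within Ts. \<tau> < \<tau>0"
        using pos[OF \<tau>0] by (intro order_tendstoD(2)[OF tendsto_ident_at]) auto
      moreover have "\<forall>\<^sub>F \<tau> in at 0 within Ts. \<tau> \<in> Ts"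
        by (auto simp: eventually_at_filter)
      ultimately show ?thesis by eventually_elim auto
    qed
    ultimately show ?thesis
    proof eventually_elim
      case (elim \<tau>)
      then have \<tau>: "\<tau> \<in> Ts" and lL: "l \<tau> \<le> L" using l_mono[OF _ \<tau>0] by (auto simp: L_def)
      have l0: "0 \<le> l \<tau>" using l[OF \<tau>] mu_nonneg by simp
      show ?case
      proof
        fix t assume t: "t \<in> {0..T}"
        have "nrm (Z t - interp (X \<tau>) \<tau> t) \<le> exp (l \<tau> * t) *
            (r \<tau> + (11 / 5 + 9 / 8 * l \<tau> * t) * (\<tau> * exp (l \<tau> * \<tau>) * nrm (a \<tau> 0)))"
          using t \<tau> by (intro error) auto
        \<comment> \<open>The error estimate is made independent of \<open>t\<close> by replacing
          the rate by \<open>L\<close> and the time by \<open>T\<close>; its right-hand side then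
          tends to 0 with \<open>\<tau>\<close>.\<close>
        also have "\<dots> \<le> exp (L * T) * (r \<tau> + (11 / 5 + 9 / 8 * L * T) * c \<tau>)"
        proof -
          have lt: "l \<tau> * t \<le> L * T" using lL l0 t L by (intro mult_mono) auto
          have "(11 / 5 + 9 / 8 * l \<tau> * t) * (\<tau> * exp (l \<tau> * \<tau>) * nrm (a \<tau> 0))
              \<le> (11 / 5 + 9 / 8 * L * T) * c \<tau>"
            using mult_left_mono[OF lt, of "9 / 8"] mult_nonneg_nonneg[of "9 / 8 * L" T] L T
              c_ge[OF \<tau> lL] pos[OF \<tau>] by (intro mult_mono) (auto simp: mult.assoc)
          moreover have "0 \<le> (11 / 5 + 9 / 8 * l \<tau> * t) * (\<tau> * exp (l \<tau> * \<tau>) * nrm (a \<tau> 0))"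
            using l0 t pos[OF \<tau>] by (intro mult_nonneg_nonneg) auto
          ultimately show ?thesis
            using lt by (intro mult_mono) (auto simp: r_def)
        qed
        also have "\<dots> \<le> K T * (r \<tau> + c \<tau>)"
          using T by (intro K) (auto simp: r_def)
        also have "\<dots> \<le> \<epsilon>" using elim by simp
        finally show "nrm (Z t - interp (X \<tau>) \<tau> t) \<le> \<epsilon>" .
      qed
    qed
  qed
  have "\<forall>T\<ge>0. \<exists>L. \<forall>s\<in>{0..T}. \<forall>t\<in>{0..T}. nrm (Z s - Z t) \<le> L * \<bar>s - t\<bar>"
    using lip_T by blast
  then show ?thesis
    using Z(1) uniform error unfolding r_def by (intro exI[of _ Z]) blast
qed

end

section \<open>Gradients, minimizers and the growth of gradients along a step\<close>

context semi_inner_space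
begin

lemma gradient_DERIV:
  assumes S: "x \<in> S" "h \<in> S"
    and G: "\<And>\<epsilon>. 0 < \<epsilon> \<Longrightarrow> \<exists>\<delta>>0. \<forall>h\<in>S. nrm h < \<delta> \<longrightarrow> \<bar>F (x + h) - F x - ip g h\<bar> \<le> \<epsilon> * nrm h"
    and g: "g \<in> S"
  shows "((\<lambda>s. F (x + s *\<^sub>R h)) has_real_derivative ip g h) (at 0)"
  unfolding DERIV_def
proof (rule LIM_I)
  fix r :: real assume r: "0 < r"
  \<comment> \<open>Adding 1 avoids division by zero when \<open>h\<close> is a null vector and
    turns the final bound into a strict one.\<close>
  let ?n = "nrm h + 1"
  have n: "0 < ?n" using nrm_nonneg[of h] by linarith
  obtain \<delta> where \<delta>: "0 < \<delta>" "\<And>h. h \<in> S \<Longrightarrow> nrm h < \<delta> \<Longrightarrow> \<bar>F (x + h) - F x - ip g h\<bar> \<le> r / ?n * nrm h"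
    using G[of "r / ?n"] r n by auto
  have "norm ((F (x + (0 + s) *\<^sub>R h) - F (x + 0 *\<^sub>R h)) / s - ip g h) < r"
    if "s \<noteq> 0" "norm (s - 0) < \<delta> / ?n" for s
  proof -
    have s: "\<bar>s\<bar> * ?n < \<delta>" using that n by (simp add: field_simps)
    have ns: "nrm (s *\<^sub>R h) = \<bar>s\<bar> * nrm h" by (rule nrm_scale[OF S(2)])
    also have "\<dots> \<le> \<bar>s\<bar> * ?n" by (intro mult_left_mono) auto
    finally have "\<bar>F (x + s *\<^sub>R h) - F x - ip g (s *\<^sub>R h)\<bar> \<le> r / ?n * (\<bar>s\<bar> * nrm h)"
      using \<delta>(2)[of "s *\<^sub>R h"] s S ns by simp
    moreover have "ip g (s *\<^sub>R h) = s * ip g h" using S g by (simp add: ip_linear)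
    ultimately have "\<bar>F (x + s *\<^sub>R h) - F x - s * ip g h\<bar> / \<bar>s\<bar> \<le> r / ?n * nrm h"
      using that(1) by (simp add: field_simps)
    also have "\<dots> < r" using r n by (simp add: field_simps)
    also have "\<bar>F (x + s *\<^sub>R h) - F x - s * ip g h\<bar> / \<bar>s\<bar> = \<bar>(F (x + s *\<^sub>R h) - F x) / s - ip g h\<bar>"
      using that(1) by (simp add: diff_divide_distrib flip: abs_divide)
    finally show ?thesis by simp
  qed
  then show "\<exists>d>0. \<forall>s. s \<noteq> 0 \<and> norm (s - 0) < d \<longrightarrow>
      norm ((F (x + (0 + s) *\<^sub>R h) - F (x + 0 *\<^sub>R h)) / s - ip g h) < r"
    using \<delta>(1) n by (intro exI[of _ "\<delta> / ?n"]) simp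
qed

text \<open>The convexity inequality is divided by \<open>t\<close> and \<open>t\<close> tends to 0
  from the right. For \<open>lam\<close>-convexity, \<open>c\<close> is \<open>lam / 2\<close> times
  the squared length of \<open>y - x\<close>.\<close>

lemma convex_subgradient:
  fixes x y :: 'v
  assumes D: "((\<lambda>s. F (x + s *\<^sub>R (y - x))) has_real_derivative k) (at 0)"
    and conv: "\<And>t. 0 \<le> t \<Longrightarrow> t \<le> 1 \<Longrightarrow> F (x + t *\<^sub>R (y - x)) \<le> (1 - t) * F x + t * F y - c * t * (1 - t)"
  shows "F x + k + c \<le> F y"
proof -
  have "((\<lambda>t. (F (x + t *\<^sub>R (y - x)) - F x) / t) \<longlongrightarrow> k) (at_right 0)"
    using D unfolding DERIV_def by (simp add: filterlim_at_split)
  moreover have "((\<lambda>t. F y - F x - c * (1 - t)) \<longlongrightarrow> F y - F x - c * (1 - 0)) (at_right 0)"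
    by (intro tendsto_intros)
  moreover have "\<forall>\<^sub>F t in at_right 0. (F (x + t *\<^sub>R (y - x)) - F x) / t \<le> F y - F x - c * (1 - t)"
    using eventually_at_right_less[of "0::real"] eventually_at_right_real[of 0 "1::real", OF zero_less_one]
  proof eventually_elim
    case (elim t)
    then have "F (x + t *\<^sub>R (y - x)) - F x \<le> t * (F y - F x - c * (1 - t))"
      using conv[of t] by (simp add: algebra_simps)
    then show ?case using elim by (simp add: divide_le_eq mult.commute)
  qed
  ultimately have "k \<le> F y - F x - c * (1 - 0)"
    by (intro tendsto_le[OF trivial_limit_at_right_real]) auto
  then show ?thesis by simp
qed

text \<open>Restricted to the line through \<open>Y\<close> in direction \<open>z\<close>, the
  objective is a differentiable real function with a minimum at 0, so only a directional derivative
  of \<open>F\<close> enters.\<close>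

lemma minimizer_Euler_Lagrange:
  assumes S: "X \<in> S" "Y \<in> S" "g \<in> S" "z \<in> S" and \<tau>: "0 < \<tau>"
    and D: "((\<lambda>s. F (Y + s *\<^sub>R z)) has_real_derivative k) (at 0)"
    and min: "\<And>\<xi>. \<xi> \<in> S \<Longrightarrow> F Y / 2 + ip g Y / 2 + (nrm (Y - X))\<^sup>2 / (2 * \<tau>)
      \<le> F \<xi> / 2 + ip g \<xi> / 2 + (nrm (\<xi> - X))\<^sup>2 / (2 * \<tau>)"
  shows "ip (Y - X) z = - \<tau> / 2 * (ip g z + k)"
proof -
  define J where "J s = F (Y + s *\<^sub>R z) / 2 + (ip g Y + s * ip g z) / 2
    + (ip (Y - X) (Y - X) + 2 * s * ip (Y - X) z + s\<^sup>2 * ip z z) / (2 * \<tau>)" for s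
  have J: "J s = F (Y + s *\<^sub>R z) / 2 + ip g (Y + s *\<^sub>R z) / 2 + (nrm (Y + s *\<^sub>R z - X))\<^sup>2 / (2 * \<tau>)" for s
    using S ip_affine_square[of "Y - X" z s]
    by (simp add: J_def nrm_square ip_add_right ip_scale_right add_diff_eq diff_add_eq)
  have "(J has_real_derivative k / 2 + ip g z / 2 + 2 * ip (Y - X) z / (2 * \<tau>)) (at 0)"
    unfolding J_def[abs_def] by (rule derivative_eq_intros D refl | use \<tau> in simp)+
  then have "k / 2 + ip g z / 2 + 2 * ip (Y - X) z / (2 * \<tau>) = 0"
    by (rule DERIV_local_min[OF _ zero_less_one]) (use min[of "Y + _ *\<^sub>R z"] S in \<open>simp add: J\<close>)
  then show ?thesis using \<tau> by (simp add: field_simps)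
qed

text \<open>Adding the two subgradient inequalities gives monotonicity of the gradient up to
  \<open>mu\<close>. The Euler-Lagrange equation turns the pairings and the squared increment into
  expressions in \<open>a0\<close> and \<open>a1\<close> alone.\<close>

lemma trap_step_gradient_growth:
  assumes S: "x0 \<in> S" "x1 \<in> S" "a0 \<in> S" "a1 \<in> S" and \<tau>: "0 < \<tau>" and mu: "0 \<le> mu"
    and EL: "\<And>z. z \<in> S \<Longrightarrow> ip (x1 - x0) z = - \<tau> / 2 * (ip a0 z + ip a1 z)"
    and sub0: "f0 + ip a0 (x1 - x0) - mu / 2 * ip (x1 - x0) (x1 - x0) \<le> f1"
    and sub1: "f1 + ip a1 (x0 - x1) - mu / 2 * ip (x0 - x1) (x0 - x1) \<le> f0"
  shows "(1 - mu * \<tau>) * (nrm a1)\<^sup>2 \<le> (1 + mu * \<tau>) * (nrm a0)\<^sup>2"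
proof -
  let ?d = "x1 - x0"
  have [simp]: "?d \<in> S" using S by simp
  have neg: "ip (x0 - x1) (x0 - x1) = ip ?d ?d" "ip a1 (x0 - x1) = - ip a1 ?d"
    using S by (simp_all add: ip_linear)
  have "f1 - ip a1 ?d - mu / 2 * ip ?d ?d \<le> f0"
    using sub1 unfolding neg by simp
  with sub0 have 1: "ip a0 ?d - ip a1 ?d \<le> mu * ip ?d ?d" by simp
  have e0: "ip a0 ?d = - \<tau> / 2 * (ip a0 a0 + ip a0 a1)" and e1: "ip a1 ?d = - \<tau> / 2 * (ip a0 a1 + ip a1 a1)"
    using EL[of a0] EL[of a1] S by (simp_all only: ip_commute[of _ ?d] ip_commute[of a1 a0])
  have "ip ?d ?d = \<tau>\<^sup>2 / 4 * (ip a0 a0 + 2 * ip a0 a1 + ip a1 a1)"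
    using EL[of ?d] unfolding e0 e1 by (simp add: power2_eq_square algebra_simps)
  \<comment> \<open>The gap between the two sides is a multiple of the square of
    \<open>a0 - a1\<close>.\<close>
  also have "\<dots> \<le> \<tau>\<^sup>2 / 4 * (2 * (ip a0 a0 + ip a1 a1))"
    using ip_nonneg[of "a0 - a1"] S by (intro mult_left_mono) (auto simp: ip_linear ip_commute[of a1 a0])
  also have "\<dots> = \<tau>\<^sup>2 / 2 * (ip a0 a0 + ip a1 a1)"
    by simp
  finally have "mu * ip ?d ?d \<le> mu * (\<tau>\<^sup>2 / 2 * (ip a0 a0 + ip a1 a1))"
    using mu by (intro mult_left_mono) auto
  with 1 have "\<tau> / 2 * (ip a1 a1 - ip a0 a0) \<le> \<tau> / 2 * (mu * \<tau> * (ip a0 a0 + ip a1 a1))"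
    unfolding e0 e1 by (simp add: power2_eq_square algebra_simps)
  then have "ip a1 a1 - ip a0 a0 \<le> mu * \<tau> * (ip a0 a0 + ip a1 a1)"
    using \<tau> by simp
  then show ?thesis by (simp add: nrm_square algebra_simps)
qed

end

section \<open>Square-integrable maps and the Wasserstein distance\<close>

lemma L2_integrable_inner:
  assumes "\<xi> \<in> L2 M" "\<eta> \<in> L2 M"
  shows "integrable M (\<lambda>x. \<xi> x \<bullet> \<eta> x)"
proof (rule Bochner_Integration.integrable_bound)
  show "integrable M (\<lambda>x. (norm (\<xi> x))\<^sup>2 + (norm (\<eta> x))\<^sup>2)"
    using assms by (auto simp: L2_def)
  show "(\<lambda>x. \<xi> x \<bullet> \<eta> x) \<in> borel_measurable M"
    using assms by (auto simp: L2_def)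
  show "AE x in M. norm (\<xi> x \<bullet> \<eta> x) \<le> norm ((norm (\<xi> x))\<^sup>2 + (norm (\<eta> x))\<^sup>2)"
  proof (rule AE_I2)
    fix x
    have "norm (\<xi> x \<bullet> \<eta> x) \<le> norm (\<xi> x) * norm (\<eta> x)"
      using Cauchy_Schwarz_ineq2 by auto
    also have "\<dots> \<le> (norm (\<xi> x))\<^sup>2 + (norm (\<eta> x))\<^sup>2"
      using sum_squares_bound[of "norm (\<xi> x)" "norm (\<eta> x)"]
        mult_nonneg_nonneg[OF norm_ge_zero[of "\<xi> x"] norm_ge_zero[of "\<eta> x"]] by linarith
    finally show "norm (\<xi> x \<bullet> \<eta> x) \<le> norm ((norm (\<xi> x))\<^sup>2 + (norm (\<eta> x))\<^sup>2)"
      by simp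
  qed
qed

lemma semi_inner_space_L2: "semi_inner_space (L2 M) (hinner M)"
proof
  show "subspace (L2 M)"
  proof (rule subspaceI)
    fix \<xi> \<eta> :: "'a \<Rightarrow> 'a" assume *: "\<xi> \<in> L2 M" "\<eta> \<in> L2 M"
    have "(norm (\<xi> x + \<eta> x))\<^sup>2 = (norm (\<xi> x))\<^sup>2 + 2 * (\<xi> x \<bullet> \<eta> x) + (norm (\<eta> x))\<^sup>2" for x
      by (simp add: power2_norm_eq_inner algebra_simps inner_commute)
    then show "\<xi> + \<eta> \<in> L2 M"
      using * L2_integrable_inner[OF *] by (auto simp: L2_def plus_fun_def)
  qed (auto simp: L2_def zero_fun_def scaleR_fun_def power_mult_distrib)
  show "hinner M (x + y) z = hinner M x z + hinner M y z" if "x \<in> L2 M" "y \<in> L2 M" "z \<in> L2 M" for x y z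
    using that by (simp add: hinner_def inner_add_left L2_integrable_inner)
qed (simp_all add: hinner_def inner_commute)

lemma nrm_hinner: "semi_inner_space.nrm (hinner M) = hnorm M"
  by (simp add: fun_eq_iff semi_inner_space.nrm_def[OF semi_inner_space_L2] hinner_def hnorm_def power2_norm_eq_inner)

lemma hnorm_square: "(hnorm M \<xi>)\<^sup>2 = (\<integral>x. (norm (\<xi> x))\<^sup>2 \<partial>M)"
  by (simp add: hnorm_def)

lemma L2_diff: "\<xi> \<in> L2 M \<Longrightarrow> \<eta> \<in> L2 M \<Longrightarrow> (\<lambda>x. \<xi> x - \<eta> x) \<in> L2 M"
  using semi_inner_space.mem_S(2)[OF semi_inner_space_L2, of \<xi> M \<eta>] by (simp add: fun_diff_def)

lemma L2_integrable:
  assumes "finite_measure M" "\<xi> \<in> L2 M"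
  shows "integrable M \<xi>"
proof -
  interpret finite_measure M by fact
  show ?thesis
  proof (rule Bochner_Integration.integrable_bound)
    show "integrable M (\<lambda>x. 1 + (norm (\<xi> x))\<^sup>2)"
      using assms(2) by (auto simp: L2_def)
    show "AE x in M. norm (\<xi> x) \<le> norm (1 + (norm (\<xi> x))\<^sup>2)"
    proof (rule AE_I2)
      fix x
      have "norm (\<xi> x) \<le> 1 + (norm (\<xi> x))\<^sup>2"
        using sum_squares_bound[of 1 "norm (\<xi> x)"] norm_ge_zero[of "\<xi> x"] unfolding power_one by linarith
      then show "norm (\<xi> x) \<le> norm (1 + (norm (\<xi> x))\<^sup>2)"
        unfolding real_norm_def by (rule order_trans[OF _ abs_ge_self])
    qed
  qed (use assms(2) in \<open>auto simp: L2_def\<close>)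
qed

text \<open>This is nonnegativity of the variance of the norm. It makes Cauchy sequences in
  \<open>L2\<close> Cauchy in mean.\<close>

lemma integral_norm_le_hnorm:
  assumes "prob_space M" "\<xi> \<in> L2 M"
  shows "(\<integral>x. norm (\<xi> x) \<partial>M) \<le> hnorm M \<xi>"
  unfolding hnorm_def
proof (rule real_le_rsqrt)
  interpret prob_space M by fact
  show "(\<integral>x. norm (\<xi> x) \<partial>M)\<^sup>2 \<le> (\<integral>x. (norm (\<xi> x))\<^sup>2 \<partial>M)"
  proof -
    have "variance (\<lambda>x. norm (\<xi> x)) = expectation (\<lambda>x. (norm (\<xi> x))\<^sup>2) - (expectation (\<lambda>x. norm (\<xi> x)))\<^sup>2"
      using L2_integrable[OF finite_measure_axioms assms(2)] assms(2)
      by (intro variance_eq) (auto simp: L2_def)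
    then show ?thesis using variance_positive[of "\<lambda>x. norm (\<xi> x)"] by linarith
  qed
qed

text \<open>Riesz-Fischer for functions rather than classes: convergence in mean supplies an almost
  everywhere convergent subsequence, and Fatou's lemma upgrades its limit to a limit in
  \<open>L2\<close>.\<close>

lemma L2_complete:
  fixes s :: "nat \<Rightarrow> 'a::euclidean_space \<Rightarrow> 'a"
  assumes "prob_space M" and s: "\<And>n. s n \<in> L2 M"
    and cauchy: "\<And>\<epsilon>. 0 < \<epsilon> \<Longrightarrow> \<exists>N. \<forall>m\<ge>N. \<forall>n\<ge>N. hnorm M (\<lambda>x. s m x - s n x) \<le> \<epsilon>"
  shows "\<exists>z\<in>L2 M. (\<lambda>n. hnorm M (\<lambda>x. s n x - z x)) \<longlonglongrightarrow> 0"
proof -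
  interpret prob_space M by fact
  have [measurable]: "s n \<in> borel_measurable M" for n using s by (auto simp: L2_def)
  have "\<exists>N. \<forall>i\<ge>N. \<forall>j\<ge>N. expectation (\<lambda>x. norm (s i x - s j x)) < e" if e: "0 < e" for e
  proof -
    obtain N where N: "\<And>i j. N \<le> i \<Longrightarrow> N \<le> j \<Longrightarrow> hnorm M (\<lambda>x. s i x - s j x) \<le> e / 2"
      using cauchy[of "e / 2"] e by auto
    have "expectation (\<lambda>x. norm (s i x - s j x)) < e" if "N \<le> i" "N \<le> j" for i j
      using integral_norm_le_hnorm[OF prob_space_axioms L2_diff[OF s s], of i j] N[OF that] e by linarith
    then show ?thesis by blast
  qed
  then obtain r where r: "strict_mono r" "AE x in M. Cauchy (\<lambda>i. s (r i) x)"
    using cauchy_L1_AE_cauchy_subseq[of M s] L2_integrable[OF finite_measure_axioms s] by blast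
  define z where "z x = lim (\<lambda>i. s (r i) x)" for x
  have [measurable]: "z \<in> borel_measurable M" unfolding z_def[abs_def] by measurable
  have AE_lim: "AE x in M. (\<lambda>i. s (r i) x) \<longlonglongrightarrow> z x"
    using r(2) by eventually_elim (simp add: z_def Cauchy_convergent convergent_LIMSEQ_iff[symmetric])
  \<comment> \<open>Fatou along the subsequence transfers a bound on \<open>s n - s m\<close> for
    all large \<open>m\<close> to \<open>s n - z\<close>, including its square
    integrability.\<close>
  have key: "(\<lambda>x. s n x - z x) \<in> L2 M \<and> hnorm M (\<lambda>x. s n x - z x) \<le> \<epsilon>"
    if N: "\<And>m. N \<le> m \<Longrightarrow> hnorm M (\<lambda>x. s n x - s m x) \<le> \<epsilon>" and \<epsilon>: "0 < \<epsilon>" for n N \<epsilon>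
  proof -
    have "(\<integral>\<^sup>+ x. ennreal ((norm (s n x - z x))\<^sup>2) \<partial>M)
        = (\<integral>\<^sup>+ x. liminf (\<lambda>i. ennreal ((norm (s n x - s (r i) x))\<^sup>2)) \<partial>M)"
    proof (rule nn_integral_cong_AE, use AE_lim in eventually_elim)
      case (elim x)
      have "(\<lambda>i. ennreal ((norm (s n x - s (r i) x))\<^sup>2)) \<longlonglongrightarrow> ennreal ((norm (s n x - z x))\<^sup>2)"
        by (intro tendsto_intros elim)
      from lim_imp_Liminf[OF trivial_limit_sequentially this] show ?case by (rule sym)
    qed
    also have "\<dots> \<le> liminf (\<lambda>i. \<integral>\<^sup>+ x. ennreal ((norm (s n x - s (r i) x))\<^sup>2) \<partial>M)"
      by (rule nn_integral_liminf) measurable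
    also have "\<dots> \<le> ennreal (\<epsilon>\<^sup>2)"
    proof (rule Liminf_le[OF _ eventually_sequentiallyI[of N]])
      fix i assume i: "N \<le> i"
      have "(\<integral>\<^sup>+ x. ennreal ((norm (s n x - s (r i) x))\<^sup>2) \<partial>M) = ennreal ((hnorm M (\<lambda>x. s n x - s (r i) x))\<^sup>2)"
        using L2_diff[OF s s, of n "r i"] by (simp add: nn_integral_eq_integral hnorm_square L2_def)
      also have "\<dots> \<le> ennreal (\<epsilon>\<^sup>2)"
        using N[of "r i"] i seq_suble[OF r(1), of i]
        by (intro ennreal_leI power_mono) (auto simp: hnorm_def)
      finally show "(\<integral>\<^sup>+ x. ennreal ((norm (s n x - s (r i) x))\<^sup>2) \<partial>M) \<le> ennreal (\<epsilon>\<^sup>2)" .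
    qed simp
    finally have le: "(\<integral>\<^sup>+ x. ennreal ((norm (s n x - z x))\<^sup>2) \<partial>M) \<le> ennreal (\<epsilon>\<^sup>2)" .
    then have int: "integrable M (\<lambda>x. (norm (s n x - z x))\<^sup>2)"
      by (intro integrableI_bounded) (auto simp: le_less_trans)
    have "ennreal ((hnorm M (\<lambda>x. s n x - z x))\<^sup>2) \<le> ennreal (\<epsilon>\<^sup>2)"
      using le by (simp add: nn_integral_eq_integral[OF int] hnorm_square)
    then have "hnorm M (\<lambda>x. s n x - z x) \<le> \<epsilon>"
      using \<epsilon> by (simp add: power2_le_iff_abs_le)
    with int show ?thesis by (simp add: L2_def)
  qed
  obtain N where "\<And>m n. N \<le> m \<Longrightarrow> N \<le> n \<Longrightarrow> hnorm M (\<lambda>x. s m x - s n x) \<le> 1"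
    using cauchy[of 1] by auto
  then have "(\<lambda>x. s N x - z x) \<in> L2 M" using key[of N N 1] by simp
  from L2_diff[OF s[of N] this] have "z \<in> L2 M" by simp
  moreover have "(\<lambda>n. hnorm M (\<lambda>x. s n x - z x)) \<longlonglongrightarrow> 0"
  proof (rule LIMSEQ_I)
    fix e :: real assume e: "0 < e"
    obtain N where N: "\<And>m n. N \<le> m \<Longrightarrow> N \<le> n \<Longrightarrow> hnorm M (\<lambda>x. s m x - s n x) \<le> e / 2"
      using cauchy[of "e / 2"] e by auto
    have "norm (hnorm M (\<lambda>x. s n x - z x) - 0) < e" if "N \<le> n" for n
      using key[of N n "e / 2"] N[OF that] e by (simp add: hnorm_def)
    then show "\<exists>N. \<forall>n\<ge>N. norm (hnorm M (\<lambda>x. s n x - z x) - 0) < e" by blast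
  qed
  ultimately show ?thesis by blast
qed

text \<open>The image of \<open>M\<close> under the pair of both maps is a coupling whose cost is
  the squared distance in \<open>L2\<close>.\<close>

lemma W2_distr_le_hnorm:
  fixes \<xi> \<eta> :: "'a::euclidean_space \<Rightarrow> 'a"
  assumes "prob_space M" and L2: "\<xi> \<in> L2 M" "\<eta> \<in> L2 M"
  shows "W2 (distr M borel \<xi>) (distr M borel \<eta>) \<le> hnorm M (\<lambda>x. \<xi> x - \<eta> x)"
proof -
  interpret prob_space M by fact
  have [measurable]: "\<xi> \<in> borel_measurable M" "\<eta> \<in> borel_measurable M"
    using L2 by (auto simp: L2_def)
  have [measurable]: "fst \<in> borel_measurable (borel :: ('a \<times> 'a) measure)"
    "snd \<in> borel_measurable (borel :: ('a \<times> 'a) measure)"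
    by (auto intro!: borel_measurable_continuous_onI continuous_intros)
  define \<pi> where "\<pi> = distr M borel (\<lambda>x. (\<xi> x, \<eta> x))"
  have "\<pi> \<in> couplings (distr M borel \<xi>) (distr M borel \<eta>)"
    unfolding couplings_def \<pi>_def by (simp add: prob_space_distr distr_distr comp_def)
  then have "(INF \<pi>\<in>couplings (distr M borel \<xi>) (distr M borel \<eta>). \<integral>\<^sup>+ p. ennreal ((norm (fst p - snd p))\<^sup>2) \<partial>\<pi>)
      \<le> (\<integral>\<^sup>+ p. ennreal ((norm (fst p - snd p))\<^sup>2) \<partial>\<pi>)"
    by (rule INF_lower)
  also have "\<dots> = (\<integral>\<^sup>+ x. ennreal ((norm (\<xi> x - \<eta> x))\<^sup>2) \<partial>M)"
    unfolding \<pi>_def by (subst nn_integral_distr) auto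
  also have "\<dots> = ennreal ((hnorm M (\<lambda>x. \<xi> x - \<eta> x))\<^sup>2)"
    using L2_diff[OF L2] by (simp add: nn_integral_eq_integral hnorm_square L2_def)
  finally have "enn2real (INF \<pi>\<in>couplings (distr M borel \<xi>) (distr M borel \<eta>).
      \<integral>\<^sup>+ p. ennreal ((norm (fst p - snd p))\<^sup>2) \<partial>\<pi>) \<le> (hnorm M (\<lambda>x. \<xi> x - \<eta> x))\<^sup>2"
    by (rule enn2real_leI[rotated]) simp
  then show ?thesis
    unfolding W2_def by (intro real_le_lsqrt) (auto simp: hnorm_def)
qed

section \<open>The growth rate of the scheme as a function of the step\<close>

lemma ln_quotient_has_derivative:
  fixes y :: real
  assumes "0 \<le> y" "y < 1"
  shows "((\<lambda>y. ln ((1 + y) / (1 - y))) has_real_derivative 2 / (1 - y * y)) (at y)"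
proof -
  have f: "1 - y * y = (1 + y) * (1 - y)" by (simp add: algebra_simps)
  have "((\<lambda>y. (1 + y) / (1 - y)) has_real_derivative 2 / ((1 - y) * (1 - y))) (at y)"
    using assms by (auto intro!: derivative_eq_intros)
  moreover have "0 < (1 + y) / (1 - y)" "1 + y \<noteq> 0" "1 - y \<noteq> 0" using assms by auto
  ultimately show ?thesis
    unfolding f by (intro DERIV_cong[OF DERIV_chain2[OF DERIV_ln_divide]]) (auto simp: divide_simps)
qed

lemma ln_quotient_ge:
  fixes x :: real
  assumes "0 \<le> x" "x < 1"
  shows "2 * x \<le> ln ((1 + x) / (1 - x))"
proof -
  have "ln ((1 + 0) / (1 - 0)) - 2 * 0 \<le> ln ((1 + x) / (1 - x)) - 2 * x"
  proof (rule DERIV_nonneg_imp_nondecreasing[OF assms(1)])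
    fix y assume y: "0 \<le> y" "y \<le> x"
    then have "y * y < 1" using mult_strict_mono[of y 1 y 1] assms by auto
    then have "0 \<le> 2 / (1 - y * y) - 2" using y by (simp add: field_simps)
    moreover have "((\<lambda>y. ln ((1 + y) / (1 - y)) - 2 * y) has_real_derivative 2 / (1 - y * y) - 2) (at y)"
      using y assms by (intro DERIV_diff ln_quotient_has_derivative DERIV_cmult_Id) auto
    ultimately show "\<exists>z. ((\<lambda>y. ln ((1 + y) / (1 - y)) - 2 * y) has_real_derivative z) (at y) \<and> 0 \<le> z"
      by blast
  qed
  then show ?thesis by simp
qed

text \<open>The function is twice the inverse hyperbolic tangent, which is convex on
  \<open>{0..<1}\<close> and vanishes at 0. Its quotient by the argument is therefore nondecreasing,
  which yields monotonicity of the rate in the step.\<close>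

lemma ln_quotient_scale:
  fixes x :: real
  assumes "0 \<le> x" "x < 1" "0 \<le> s" "s \<le> 1"
  shows "ln ((1 + s * x) / (1 - s * x)) \<le> s * ln ((1 + x) / (1 - x))"
proof -
  have "convex_on {0..<1} (\<lambda>y::real. ln ((1 + y) / (1 - y)))"
  proof (rule convex_on_realI[where f' = "\<lambda>y. 2 / (1 - y * y)"])
    fix y z :: real assume yz: "y \<in> {0..<1}" "z \<in> {0..<1}" "y \<le> z"
    then have "y * y \<le> z * z" "z * z < 1" using mult_strict_mono[of z 1 z 1] by (auto intro: mult_mono)
    then show "2 / (1 - y * y) \<le> 2 / (1 - z * z)" by (intro divide_left_mono) auto
  qed (auto intro!: ln_quotient_has_derivative)
  from convex_onD[OF this, of s 0 x] assms show ?thesis by simp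
qed

text \<open>In the convex case gradient norms do not grow, so the rate is 0. For negative
  \<open>lam\<close> it is the absolute value of \<open>lambda_tau lam \<tau>\<close>, as the latter
  is then negative for admissible steps.\<close>

definition trap_rate :: "real \<Rightarrow> real \<Rightarrow> real" where
  "trap_rate lam \<tau> = (if 0 \<le> lam then 0 else - lambda_tau lam \<tau>)"

lemma trap_rate_neg:
  assumes "lam < 0" "0 < \<tau>" "\<bar>lam\<bar> * \<tau> < 1"
  shows "trap_rate lam \<tau> = ln ((1 + \<bar>lam\<bar> * \<tau>) / (1 - \<bar>lam\<bar> * \<tau>)) / (2 * \<tau>)"
proof -
  have "0 < 1 + lam * \<tau>" "0 < 1 - lam * \<tau>" using assms mult_pos_pos[of "- lam" \<tau>] by auto
  then show ?thesis
    using assms by (simp add: trap_rate_def lambda_tau_def ln_div field_simps)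
qed

lemma trap_rate_ge:
  assumes "0 < \<tau>" "lam < 0 \<Longrightarrow> \<bar>lam\<bar> * \<tau> < 1"
  shows "max 0 (- lam) \<le> trap_rate lam \<tau>"
proof (cases "0 \<le> lam")
  case False
  then have "lam < 0" "\<bar>lam\<bar> * \<tau> < 1" using assms by auto
  moreover have "0 \<le> \<bar>lam\<bar> * \<tau>" using assms(1) by (intro mult_nonneg_nonneg) auto
  ultimately show ?thesis
    using divide_right_mono[OF ln_quotient_ge[of "\<bar>lam\<bar> * \<tau>"], of "2 * \<tau>"] assms(1)
    unfolding trap_rate_neg[OF \<open>lam < 0\<close> assms(1) \<open>\<bar>lam\<bar> * \<tau> < 1\<close>] by simp
qed (simp add: trap_rate_def)

lemma trap_rate_mono:
  assumes "0 < \<eta>" "\<eta> \<le> \<tau>" "lam < 0 \<Longrightarrow> \<bar>lam\<bar> * \<tau> < 1"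
  shows "trap_rate lam \<eta> \<le> trap_rate lam \<tau>"
proof (cases "0 \<le> lam")
  case False
  then have \<tau>: "\<bar>lam\<bar> * \<tau> < 1" using assms by simp
  have "\<bar>lam\<bar> * \<eta> \<le> \<bar>lam\<bar> * \<tau>" using assms by (intro mult_left_mono) auto
  with \<tau> have \<eta>: "\<bar>lam\<bar> * \<eta> < 1" by simp
  have "\<eta> / \<tau> * (\<bar>lam\<bar> * \<tau>) = \<bar>lam\<bar> * \<eta>" using assms by simp
  moreover have "0 \<le> \<bar>lam\<bar> * \<tau>" "0 \<le> \<eta> / \<tau>" "\<eta> / \<tau> \<le> 1" using assms by auto
  ultimately have "ln ((1 + \<bar>lam\<bar> * \<eta>) / (1 - \<bar>lam\<bar> * \<eta>)) \<le> \<eta> / \<tau> * ln ((1 + \<bar>lam\<bar> * \<tau>) / (1 - \<bar>lam\<bar> * \<tau>))"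
    using ln_quotient_scale[of "\<bar>lam\<bar> * \<tau>" "\<eta> / \<tau>"] \<tau> by (simp only:)
  then have "ln ((1 + \<bar>lam\<bar> * \<eta>) / (1 - \<bar>lam\<bar> * \<eta>)) / (2 * \<eta>)
      \<le> \<eta> / \<tau> * ln ((1 + \<bar>lam\<bar> * \<tau>) / (1 - \<bar>lam\<bar> * \<tau>)) / (2 * \<eta>)"
    using assms by (intro divide_right_mono) auto
  then show ?thesis
    using False assms \<tau> \<eta> by (simp add: trap_rate_neg)
qed (simp add: trap_rate_def)

text \<open>Identifies the growth factor of the squared gradient norm per step as
  \<open>(exp (trap_rate lam \<tau> * \<tau>))\<^sup>2\<close>; with \<open>max 0 (- lam)\<close>
  both signs of \<open>lam\<close> are covered.\<close>

lemma exp_trap_rate: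
  assumes "0 < \<tau>" "lam < 0 \<Longrightarrow> \<bar>lam\<bar> * \<tau> < 1"
  shows "(1 - max 0 (- lam) * \<tau>) * (exp (trap_rate lam \<tau> * \<tau>))\<^sup>2 = 1 + max 0 (- lam) * \<tau>"
proof (cases "0 \<le> lam")
  case False
  then have lt: "\<bar>lam\<bar> * \<tau> < 1" using assms by simp
  then have "0 < (1 + \<bar>lam\<bar> * \<tau>) / (1 - \<bar>lam\<bar> * \<tau>)" using assms by (auto intro!: divide_pos_pos add_pos_nonneg)
  then have "exp (2 * (trap_rate lam \<tau> * \<tau>)) = (1 + \<bar>lam\<bar> * \<tau>) / (1 - \<bar>lam\<bar> * \<tau>)"
    using False assms lt by (simp add: trap_rate_neg)
  then show ?thesis using False lt by (simp add: exp_double max_def)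
qed (simp add: trap_rate_def)

section \<open>Comparison with the required constants\<close>

lemma error_bound_nonneg_rate:
  fixes r g :: real
  assumes "0 \<le> r" "0 \<le> g" "0 \<le> \<tau>"
  shows "r + 11 / 5 * (\<tau> * g) \<le> sqrt 3 * r + sqrt 33 / 2 * \<tau> * g"
proof -
  have "22 / 5 \<le> sqrt (33::real)" "1 \<le> sqrt (3::real)"
    by (rule real_le_rsqrt, simp add: power2_eq_square)+
  then have "1 * r \<le> sqrt 3 * r" "11 / 5 * (\<tau> * g) \<le> sqrt 33 / 2 * (\<tau> * g)"
    using assms by (intro mult_right_mono; simp)+
  then show ?thesis by (simp add: mult.assoc)
qed

text \<open>The square root in \<open>Cconst\<close> is at least \<open>exp (l * \<tau>)\<close>, so
  \<open>Cconst\<close> dominates \<open>(2 + l * t) * exp (l * \<tau>)\<close>; together with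
  \<open>sqrt 3 \<ge> 3 / 2\<close> this exceeds 11/5 and 9/8 coefficientwise.\<close>

lemma error_bound_Cconst:
  fixes r g :: real
  assumes "0 \<le> r" "0 \<le> g" "0 \<le> \<tau>" "0 \<le> t" "0 \<le> l"
  shows "exp (l * t) * (r + (11 / 5 + 9 / 8 * l * t) * (\<tau> * exp (l * \<tau>) * g))
    \<le> sqrt 3 * exp (l * t) * r + sqrt 3 * Cconst (- l) t \<tau> * \<tau> * exp (l * t) * g"
proof -
  have s3: "3 / 2 \<le> sqrt (3::real)"
    by (rule real_le_rsqrt) (simp add: power2_eq_square)
  have "exp (l * \<tau>) = sqrt (exp (2 * l * \<tau>))"
    by (rule real_sqrt_unique[symmetric]) (simp_all add: mult.assoc exp_double)
  also have "\<dots> \<le> sqrt (3 / 4 + (1 + 7 / 3 * l * (t + \<tau>)) * exp (2 * l * \<tau>))"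
  proof (rule real_sqrt_le_mono)
    have "0 \<le> 7 / 3 * l * (t + \<tau>) * exp (2 * l * \<tau>)" using assms by simp
    then show "exp (2 * l * \<tau>) \<le> 3 / 4 + (1 + 7 / 3 * l * (t + \<tau>)) * exp (2 * l * \<tau>)"
      unfolding distrib_right by linarith
  qed
  finally have "(1 + l * (t + \<tau>)) * exp (l * \<tau>) + exp (l * \<tau>) \<le> Cconst (- l) t \<tau>"
    using assms by (simp add: Cconst_def)
  moreover have "(1 + l * t) * exp (l * \<tau>) \<le> (1 + l * (t + \<tau>)) * exp (l * \<tau>)"
    using assms by (intro mult_right_mono) (auto intro!: mult_left_mono)
  ultimately have C: "(2 + l * t) * exp (l * \<tau>) \<le> Cconst (- l) t \<tau>"
    by (simp add: algebra_simps)
  have "11 / 5 + 9 / 8 * l * t \<le> 3 / 2 * (2 + l * t)"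
    using mult_nonneg_nonneg[OF assms(5,4)] by (simp add: algebra_simps)
  also have "\<dots> \<le> sqrt 3 * (2 + l * t)"
    using s3 assms by (intro mult_right_mono) auto
  finally have "(11 / 5 + 9 / 8 * l * t) * exp (l * \<tau>) \<le> sqrt 3 * (2 + l * t) * exp (l * \<tau>)"
    by (intro mult_right_mono) auto
  also have "\<dots> \<le> sqrt 3 * Cconst (- l) t \<tau>"
    using C by (simp only: mult.assoc) (intro mult_left_mono, auto)
  finally have "(11 / 5 + 9 / 8 * l * t) * exp (l * \<tau>) * (\<tau> * g) \<le> sqrt 3 * Cconst (- l) t \<tau> * (\<tau> * g)"
    using assms by (intro mult_right_mono) auto
  moreover have "1 * r \<le> sqrt 3 * r"
    using s3 assms by (intro mult_right_mono) auto
  ultimately have "r + (11 / 5 + 9 / 8 * l * t) * exp (l * \<tau>) * (\<tau> * g)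
      \<le> sqrt 3 * r + sqrt 3 * Cconst (- l) t \<tau> * (\<tau> * g)"
    by linarith
  then have "exp (l * t) * (r + (11 / 5 + 9 / 8 * l * t) * exp (l * \<tau>) * (\<tau> * g))
      \<le> exp (l * t) * (sqrt 3 * r + sqrt 3 * Cconst (- l) t \<tau> * (\<tau> * g))"
    by (intro mult_left_mono) auto
  then show ?thesis by (simp only: distrib_left mult_ac)
qed

theorem mainTheorem13:
  fixes \<rho>0 :: "'a::euclidean_space measure"
    and \<phi> :: "'a measure \<Rightarrow> real"
    and grad :: "('a \<Rightarrow> 'a) \<Rightarrow> ('a \<Rightarrow> 'a)"
    and lam :: real
    and Ts :: "real set"
    and X :: "real \<Rightarrow> nat \<Rightarrow> ('a \<Rightarrow> 'a)"
  assumes rho0: "\<rho>0 \<in> P2"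
    and grad: "frechet_gradient \<rho>0 (lift \<phi> \<rho>0) grad"
    and conv: "lambda_convex \<rho>0 lam (lift \<phi> \<rho>0)"
    and bdd_below: "\<exists>c. \<forall>\<xi>\<in>L2 \<rho>0. c \<le> lift \<phi> \<rho>0 \<xi>"
    and Ts_pos: "Ts \<subseteq> {0<..}"
    and Ts_lim: "0 islimpt Ts"
    and step_cond: "\<And>\<tau>. \<tau> \<in> Ts \<Longrightarrow> lam / 2 + 1 / \<tau> > 0"
    and neg_cond: "\<And>\<tau>. \<tau> \<in> Ts \<Longrightarrow> lam < 0 \<Longrightarrow> \<bar>lam\<bar> * \<tau> < 1"
    and init: "\<And>\<tau>. \<tau> \<in> Ts \<Longrightarrow> X \<tau> 0 \<in> L2 \<rho>0"
    and scheme: "\<And>\<tau> n. \<tau> \<in> Ts \<Longrightarrow> trap_step \<rho>0 (lift \<phi> \<rho>0) grad \<tau> (X \<tau> n) (X \<tau> (Suc n))"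
    and init_conv: "((\<lambda>\<tau>. hnorm \<rho>0 (\<lambda>x. X \<tau> 0 x - x)) \<longlongrightarrow> 0) (at 0 within Ts)"
    and init_grad: "\<exists>B. \<forall>\<tau>\<in>Ts. hnorm \<rho>0 (grad (X \<tau> 0)) \<le> B"
  shows "\<exists>Xl :: real \<Rightarrow> ('a \<Rightarrow> 'a).
     (\<forall>t\<ge>0. Xl t \<in> L2 \<rho>0) \<and>
     (\<forall>T\<ge>0. \<exists>L. \<forall>s\<in>{0..T}. \<forall>t\<in>{0..T}. hnorm \<rho>0 (\<lambda>x. Xl s x - Xl t x) \<le> L * \<bar>s - t\<bar>) \<and>
     (\<forall>T>0. \<forall>\<epsilon>>0. \<forall>\<^sub>F \<tau> in at 0 within Ts.
         \<forall>t\<in>{0..T}. hnorm \<rho>0 (\<lambda>x. Xl t x - interp (X \<tau>) \<tau> t x) \<le> \<epsilon>) \<and>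
     (\<forall>t\<ge>0. \<forall>\<tau>\<in>Ts.
        W2 (distr \<rho>0 borel (Xl t)) (distr \<rho>0 borel (interp (X \<tau>) \<tau> t))
          \<le> hnorm \<rho>0 (\<lambda>x. Xl t x - interp (X \<tau>) \<tau> t x) \<and>
        hnorm \<rho>0 (\<lambda>x. Xl t x - interp (X \<tau>) \<tau> t x)
          \<le> (if lam \<ge> 0 then
               sqrt 3 * hnorm \<rho>0 (\<lambda>x. X \<tau> 0 x - x)
                 + sqrt 33 / 2 * \<tau> * hnorm \<rho>0 (grad (X \<tau> 0))
             else
               sqrt 3 * exp (- lambda_tau lam \<tau> * t) * hnorm \<rho>0 (\<lambda>x. X \<tau> 0 x - x)
                 + sqrt 3 * Cconst (lambda_tau lam \<tau>) t \<tau> * \<tau> * exp (- lambda_tau lam \<tau> * t)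
                   * hnorm \<rho>0 (grad (X \<tau> 0))))"
proof -
  interpret prob_space \<rho>0 using rho0 by (simp add: P2_def)
  interpret semi_inner_space "L2 \<rho>0" "hinner \<rho>0" by (rule semi_inner_space_L2)
  define F where "F = lift \<phi> \<rho>0"
  define mu where "mu = max 0 (- lam)"
  have nrm: "nrm = hnorm \<rho>0" by (rule nrm_hinner)
  have hdiff: "hnorm \<rho>0 (\<lambda>x. \<xi> x - \<eta> x) = nrm (\<xi> - \<eta>)" for \<xi> \<eta> :: "'a \<Rightarrow> 'a"
    unfolding nrm fun_diff_def ..
  have grad_mem: "grad \<xi> \<in> L2 \<rho>0" if "\<xi> \<in> L2 \<rho>0" for \<xi>
    using grad that by (simp add: frechet_gradient_def)
  have deriv: "((\<lambda>s. F (\<xi> + s *\<^sub>R h)) has_real_derivative hinner \<rho>0 (grad \<xi>) h) (at 0)"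
    if "\<xi> \<in> L2 \<rho>0" "h \<in> L2 \<rho>0" for \<xi> h
  proof (rule gradient_DERIV[OF that _ grad_mem[OF that(1)]])
    fix \<epsilon> :: real assume "0 < \<epsilon>"
    then show "\<exists>\<delta>>0. \<forall>h\<in>L2 \<rho>0. nrm h < \<delta> \<longrightarrow> \<bar>F (\<xi> + h) - F \<xi> - hinner \<rho>0 (grad \<xi>) h\<bar> \<le> \<epsilon> * nrm h"
      using grad that(1) unfolding frechet_gradient_def nrm F_def plus_fun_def by blast
  qed
  have conv_lam: "F (\<xi> + s *\<^sub>R (\<eta> - \<xi>)) \<le> (1 - s) * F \<xi> + s * F \<eta>
      - lam / 2 * s * (1 - s) * hinner \<rho>0 (\<eta> - \<xi>) (\<eta> - \<xi>)"
    if "\<xi> \<in> L2 \<rho>0" "\<eta> \<in> L2 \<rho>0" "0 \<le> s" "s \<le> 1" for \<xi> \<eta> s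
  proof -
    have "(\<lambda>x. (1 - s) *\<^sub>R \<xi> x + s *\<^sub>R \<eta> x) = \<xi> + s *\<^sub>R (\<eta> - \<xi>)"
      by (simp add: fun_eq_iff algebra_simps)
    moreover have "(hnorm \<rho>0 (\<lambda>x. \<xi> x - \<eta> x))\<^sup>2 = hinner \<rho>0 (\<eta> - \<xi>) (\<eta> - \<xi>)"
      unfolding hdiff nrm_minus_commute[OF that(1,2)] by (rule nrm_square)
    ultimately show ?thesis
      using lambda_convex_def[THEN iffD1, OF conv, rule_format, OF that(1,2), of s] that(3,4)
      unfolding F_def by simp
  qed
  \<comment> \<open>Positive convexity is discarded: from here on only the negative part
    \<open>mu\<close> of \<open>lam\<close> enters, which unifies both cases.\<close>
  have weaken: "- (lam / 2 * c) \<le> mu / 2 * c" if "0 \<le> c" for c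
    using mult_right_mono[of "- lam" mu c] that by (simp add: mu_def)
  interpret semiconvex_flow "L2 \<rho>0" "hinner \<rho>0" F mu
  proof
    show "0 \<le> mu" by (simp add: mu_def)
    fix \<xi> \<eta> and s :: real
    assume *: "\<xi> \<in> L2 \<rho>0" "\<eta> \<in> L2 \<rho>0" "0 \<le> s" "s \<le> 1"
    have "0 \<le> s * (1 - s) * hinner \<rho>0 (\<eta> - \<xi>) (\<eta> - \<xi>)" using * ip_nonneg by simp
    from conv_lam[OF *] weaken[OF this]
    show "F (\<xi> + s *\<^sub>R (\<eta> - \<xi>)) \<le> (1 - s) * F \<xi> + s * F \<eta> + mu / 2 * s * (1 - s) * hinner \<rho>0 (\<eta> - \<xi>) (\<eta> - \<xi>)"
      by (simp add: mult.assoc)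
  qed
  have sub: "F \<xi> + hinner \<rho>0 (grad \<xi>) (\<eta> - \<xi>) - mu / 2 * hinner \<rho>0 (\<eta> - \<xi>) (\<eta> - \<xi>) \<le> F \<eta>"
    if "\<xi> \<in> L2 \<rho>0" "\<eta> \<in> L2 \<rho>0" for \<xi> \<eta>
  proof -
    have "F \<xi> + hinner \<rho>0 (grad \<xi>) (\<eta> - \<xi>) + lam / 2 * hinner \<rho>0 (\<eta> - \<xi>) (\<eta> - \<xi>) \<le> F \<eta>"
    proof (rule convex_subgradient[where F = F])
      show "((\<lambda>s. F (\<xi> + s *\<^sub>R (\<eta> - \<xi>))) has_real_derivative hinner \<rho>0 (grad \<xi>) (\<eta> - \<xi>)) (at 0)"
        using that by (intro deriv) auto
      fix t :: real assume "0 \<le> t" "t \<le> 1"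
      from conv_lam[OF that this] show "F (\<xi> + t *\<^sub>R (\<eta> - \<xi>)) \<le> (1 - t) * F \<xi> + t * F \<eta>
          - lam / 2 * hinner \<rho>0 (\<eta> - \<xi>) (\<eta> - \<xi>) * t * (1 - t)"
        by (simp only: mult_ac)
    qed
    then show ?thesis using weaken[OF ip_nonneg, of "\<eta> - \<xi>"] by linarith
  qed
  define l where "l = trap_rate lam"
  have pos: "0 < \<tau>" if "\<tau> \<in> Ts" for \<tau> using Ts_pos that by auto
  have mem: "X \<tau> n \<in> L2 \<rho>0" if "\<tau> \<in> Ts" for \<tau> n
    using init[OF that] scheme[OF that] by (cases n) (auto simp: trap_step_def)
  have rate: "mu \<le> l \<tau>" if "\<tau> \<in> Ts" for \<tau>
    unfolding mu_def l_def using trap_rate_ge[OF pos[OF that] neg_cond[OF that]] .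
  have mu_\<tau>: "mu * \<tau> < 1" if "\<tau> \<in> Ts" for \<tau>
    using neg_cond[OF that] by (cases "lam < 0") (auto simp: mu_def)
  have run: "trap_run (l \<tau>) \<tau> (X \<tau>) (\<lambda>n. grad (X \<tau> n))" if \<tau>: "\<tau> \<in> Ts" for \<tau>
  proof -
    have EL: "hinner \<rho>0 (X \<tau> (Suc n) - X \<tau> n) z
        = - \<tau> / 2 * (hinner \<rho>0 (grad (X \<tau> n)) z + hinner \<rho>0 (grad (X \<tau> (Suc n))) z)"
      if z: "z \<in> L2 \<rho>0" for n z
    proof (rule minimizer_Euler_Lagrange[where F = F])
      fix \<xi> assume "\<xi> \<in> L2 \<rho>0"
      then show "F (X \<tau> (Suc n)) / 2 + hinner \<rho>0 (grad (X \<tau> n)) (X \<tau> (Suc n)) / 2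
          + (nrm (X \<tau> (Suc n) - X \<tau> n))\<^sup>2 / (2 * \<tau>)
        \<le> F \<xi> / 2 + hinner \<rho>0 (grad (X \<tau> n)) \<xi> / 2 + (nrm (\<xi> - X \<tau> n))\<^sup>2 / (2 * \<tau>)"
        using scheme[OF \<tau>, of n] unfolding trap_step_def trap_objective_def F_def hdiff by blast
    qed (use mem[OF \<tau>] grad_mem z pos[OF \<tau>] deriv in auto)
    \<comment> \<open>The factor \<open>1 - mu * \<tau>\<close> is positive for admissible steps,
      hence can be cancelled from both sides.\<close>
    have growth: "nrm (grad (X \<tau> (Suc n))) \<le> exp (l \<tau> * \<tau>) * nrm (grad (X \<tau> n))" for n
    proof (rule power2_le_imp_le)
      have "(1 - mu * \<tau>) * (nrm (grad (X \<tau> (Suc n))))\<^sup>2 \<le> (1 + mu * \<tau>) * (nrm (grad (X \<tau> n)))\<^sup>2"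
        by (rule trap_step_gradient_growth[OF _ _ _ _ pos[OF \<tau>] mu_nonneg EL sub sub])
          (use mem[OF \<tau>] grad_mem in auto)
      also have "\<dots> = (1 - mu * \<tau>) * (exp (l \<tau> * \<tau>) * nrm (grad (X \<tau> n)))\<^sup>2"
        using exp_trap_rate[OF pos[OF \<tau>] neg_cond[OF \<tau>]]
        by (simp add: mu_def l_def power_mult_distrib flip: mult.assoc)
      finally show "(nrm (grad (X \<tau> (Suc n))))\<^sup>2 \<le> (exp (l \<tau> * \<tau>) * nrm (grad (X \<tau> n)))\<^sup>2"
        using mu_\<tau>[OF \<tau>] by simp
    qed simp
    have "nrm (grad (X \<tau> n)) \<le> exp (l \<tau> * (real n * \<tau>)) * nrm (grad (X \<tau> 0))" for n
    proof (induction n)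
      case (Suc n)
      have "nrm (grad (X \<tau> (Suc n))) \<le> exp (l \<tau> * \<tau>) * (exp (l \<tau> * (real n * \<tau>)) * nrm (grad (X \<tau> 0)))"
        using Suc by (intro order_trans[OF growth] mult_left_mono) auto
      also have "\<dots> = exp (l \<tau> * (real (Suc n) * \<tau>)) * nrm (grad (X \<tau> 0))"
        by (simp add: distrib_left distrib_right exp_add mult_ac)
      finally show ?case .
    qed simp
    then show ?thesis
      unfolding trap_run_def
      using pos[OF \<tau>] mu_\<tau>[OF \<tau>] mem[OF \<tau>] grad_mem EL sub by auto
  qed
  \<comment> \<open>Square integrability of the identity map is the finite second moment of
    \<open>\<rho>0\<close>.\<close>
  have id: "(\<lambda>x. x) \<in> L2 \<rho>0"
    using rho0 by (auto simp: P2_def L2_def cong: measurable_cong_sets)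
  obtain B where B: "\<And>\<tau>. \<tau> \<in> Ts \<Longrightarrow> nrm (grad (X \<tau> 0)) \<le> B"
    using init_grad nrm by auto
  have "\<exists>Z. (\<forall>t\<ge>0. Z t \<in> L2 \<rho>0) \<and>
    (\<forall>T\<ge>0. \<exists>L. \<forall>s\<in>{0..T}. \<forall>t\<in>{0..T}. nrm (Z s - Z t) \<le> L * \<bar>s - t\<bar>) \<and>
    (\<forall>T>0. \<forall>\<epsilon>>0. \<forall>\<^sub>F \<tau> in at 0 within Ts. \<forall>t\<in>{0..T}. nrm (Z t - interp (X \<tau>) \<tau> t) \<le> \<epsilon>) \<and>
    (\<forall>t\<ge>0. \<forall>\<tau>\<in>Ts. nrm (Z t - interp (X \<tau>) \<tau> t) \<le> exp (l \<tau> * t) *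
       (nrm (X \<tau> 0 - (\<lambda>x. x)) + (11 / 5 + 9 / 8 * l \<tau> * t) * (\<tau> * exp (l \<tau> * \<tau>) * nrm (grad (X \<tau> 0)))))"
  proof (rule trap_runs_converge[OF _ Ts_pos Ts_lim run rate _ id _ B])
    fix s :: "nat \<Rightarrow> 'a \<Rightarrow> 'a"
    assume "\<And>n. s n \<in> L2 \<rho>0" "\<And>\<epsilon>. 0 < \<epsilon> \<Longrightarrow> \<exists>N. \<forall>m\<ge>N. \<forall>n\<ge>N. nrm (s m - s n) \<le> \<epsilon>"
    then show "\<exists>z\<in>L2 \<rho>0. (\<lambda>n. nrm (s n - z)) \<longlonglongrightarrow> 0"
      using L2_complete[OF prob_space_axioms, of s] unfolding hdiff by blast
  next
    fix \<eta> \<tau> assume "\<eta> \<in> Ts" "\<tau> \<in> Ts" "\<eta> \<le> \<tau>"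
    then show "l \<eta> \<le> l \<tau>"
      unfolding l_def using trap_rate_mono pos neg_cond by blast
  next
    show "((\<lambda>\<tau>. nrm (X \<tau> 0 - (\<lambda>x. x))) \<longlongrightarrow> 0) (at 0 within Ts)"
      using init_conv unfolding hdiff .
  qed
  then obtain Z where Z: "\<And>t. 0 \<le> t \<Longrightarrow> Z t \<in> L2 \<rho>0"
    "\<forall>T\<ge>0. \<exists>L. \<forall>s\<in>{0..T}. \<forall>t\<in>{0..T}. nrm (Z s - Z t) \<le> L * \<bar>s - t\<bar>"
    "\<forall>T>0. \<forall>\<epsilon>>0. \<forall>\<^sub>F \<tau> in at 0 within Ts. \<forall>t\<in>{0..T}. nrm (Z t - interp (X \<tau>) \<tau> t) \<le> \<epsilon>"
    and error: "\<And>t \<tau>. 0 \<le> t \<Longrightarrow> \<tau> \<in> Ts \<Longrightarrow> nrm (Z t - interp (X \<tau>) \<tau> t) \<le> exp (l \<tau> * t) *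
       (nrm (X \<tau> 0 - (\<lambda>x. x)) + (11 / 5 + 9 / 8 * l \<tau> * t) * (\<tau> * exp (l \<tau> * \<tau>) * nrm (grad (X \<tau> 0))))"
    by blast
  have W: "W2 (distr \<rho>0 borel (Z t)) (distr \<rho>0 borel (interp (X \<tau>) \<tau> t)) \<le> nrm (Z t - interp (X \<tau>) \<tau> t)"
    if "0 \<le> t" "\<tau> \<in> Ts" for t \<tau>
    using W2_distr_le_hnorm[OF prob_space_axioms Z(1)[OF that(1)] interp_mem[OF run[OF that(2)]]]
    unfolding hdiff .
  have bound: "nrm (Z t - interp (X \<tau>) \<tau> t)
      \<le> (if lam \<ge> 0 then
           sqrt 3 * nrm (X \<tau> 0 - (\<lambda>x. x)) + sqrt 33 / 2 * \<tau> * nrm (grad (X \<tau> 0))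
         else
           sqrt 3 * exp (- lambda_tau lam \<tau> * t) * nrm (X \<tau> 0 - (\<lambda>x. x))
             + sqrt 3 * Cconst (lambda_tau lam \<tau>) t \<tau> * \<tau> * exp (- lambda_tau lam \<tau> * t)
               * nrm (grad (X \<tau> 0)))" if "0 \<le> t" "\<tau> \<in> Ts" for t \<tau>
  proof (cases "lam \<ge> 0")
    case True
    then have "l \<tau> = 0" by (simp add: l_def trap_rate_def)
    then show ?thesis
      using error[OF that] error_bound_nonneg_rate[of "nrm (X \<tau> 0 - (\<lambda>x. x))" "nrm (grad (X \<tau> 0))" \<tau>]
        pos[OF that(2)] True by simp
  next
    case False
    then have "l \<tau> = - lambda_tau lam \<tau>" by (simp add: l_def trap_rate_def)
    then show ?thesis
      using error[OF that] error_bound_Cconst[of "nrm (X \<tau> 0 - (\<lambda>x. x))" "nrm (grad (X \<tau> 0))" \<tau> t "l \<tau>"]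
        pos[OF that(2)] that False rate[OF that(2)] mu_nonneg by simp
  qed
  show ?thesis
    using Z W bound unfolding hdiff unfolding nrm[symmetric] by (intro exI[of _ Z]) blast
qed

end
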